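(* Let $j,k,\ell\ge 0$ be integers with $j\ne 1$, let $F\in M_{(j,k)}(\Gamma_2)$ be a vector-valued Siegel modular form of degree $2$ and weight $\mathrm{Sym}^j(\mathrm{St})\otimes\det^k(\mathrm{St})$, and let $\phi\in M_\ell(\Gamma_2)$ be a classical Siegel modular form of degree $2$ and weight $\ell$. Define $$\{F,\phi\}:=\frac{1}{(j-1)\,2\pi i}\Bigl((k+j/2-1)\,W\bigl(\tfrac{d\phi}{d\tau}\bigr)F-\ell\,\phi\,W\bigl(\tfrac{d}{d\tau}\bigr)F\Bigr).$$ Then $\{F,\phi\}$ is a Siegel modular form of weight $(j,k+\ell+1)$, i.e. $\{F,\phi\}\in M_{(j,k+\ell+1)}(\Gamma_2)$.
   Context: Let $\Gamma_2=\mathrm{Sp}(4,\mathbb{Z})$ and let $\mathcal{H}_2$ be the Siegel upper half-space of degree $2$, with elements $\tau=\begin{pmatrix}\tau_1 & z \\ z & \tau_2\end{pmatrix}$. For $\gamma=\begin{pmatrix}a & b \\ c & d\end{pmatrix}\in\Gamma_2$ put $\gamma\cdot\tau=(a\tau+b)(c\tau+d)^{-1}$ and $j(\gamma,\tau)=c\tau+d$. Let $H_j\subset\mathbb{C}[x,y]$ be the space of homogeneous polynomials of degree $j$. The representation $\rho=(j,k):=\mathrm{Sym}^j(\mathrm{St})\otimes\det^k(\mathrm{St})$ of $\mathrm{GL}(2,\mathbb{C})$ is realized on $H_j$ by $(\rho(G)p)(x,y)=\det(G)^k\,p((x,y)G)$. $M_{(j,k)}(\Gamma_2)$ is the space of holomorphic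 functions $f:\mathcal{H}_2\to H_j$ with $f(\gamma\cdot\tau)=\rho(j(\gamma,\tau))f(\tau)$ for all $\gamma\in\Gamma_2$, $\tau\in\mathcal{H}_2$, and $M_\ell(\Gamma_2)=M_{(0,\ell)}(\Gamma_2)$. Write $\frac{d}{d\tau}=\begin{pmatrix}\partial/\partial\tau_1 & \frac12\partial/\partial z \\ \frac12\partial/\partial z & \partial/\partial\tau_2\end{pmatrix}$. For a symmetric $2\times2$ matrix $\mathbf{r}=(\mathbf{r}_{ij})$ define the operator on $H_j$ $$W(\mathbf{r})=\begin{vmatrix}\mathbf{r}_{11} & \mathbf{r}_{12} & \mathbf{r}_{22} \\ y^2 & -xy & x^2 \\ \frac{\partial^2}{\partial x^2} & \frac{\partial^2}{\partial x\partial y} & \frac{\partial^2}{\partial y^2}\end{vmatrix},$$ where in the expansion of the determinant the $x,y$-derivatives act first and one then multiplies by the polynomials of the second row. In $W(\frac{d\phi}{d\tau})F$ the matrix $\mathbf{r}$ is the matrix of functions $\frac{d\phi}{d\tau}$; in $W(\frac{d}{d\tau})F$ the entries of $\mathbf{r}=\frac{d}{d\tau}$ act as differential operators in $\tau$ on $F$. *)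

theory Defs
  imports "HOL-Complex_Analysis.Complex_Analysis"
begin

section \<open>The group Sp(4,Z) and the Siegel upper half-space of degree 2\<close>

text \<open>The index type is the sum \<open>2 + 2\<close>, so that the four blocks
  of a matrix are selected by \<^const>\<open>Inl\<close> and \<^const>\<open>Inr\<close>.\<close>

definition sympl_J :: "int ^ (2 + 2) ^ (2 + 2)" where
  "sympl_J = (\<chi> r s. case (r, s) of
      (Inl i, Inr k) \<Rightarrow> if i = k then 1 else 0
    | (Inr i, Inl k) \<Rightarrow> if i = k then - 1 else 0
    | _ \<Rightarrow> 0)"

definition Sp4Z :: "(int ^ (2 + 2) ^ (2 + 2)) set" where
  "Sp4Z = {\<gamma>. transpose \<gamma> ** sympl_J ** \<gamma> = sympl_J}"

definition block_a :: "int ^ (2 + 2) ^ (2 + 2) \<Rightarrow> complex ^ 2 ^ 2" where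
  "block_a \<gamma> = (\<chi> i k. of_int (\<gamma> $ Inl i $ Inl k))"

definition block_b :: "int ^ (2 + 2) ^ (2 + 2) \<Rightarrow> complex ^ 2 ^ 2" where
  "block_b \<gamma> = (\<chi> i k. of_int (\<gamma> $ Inl i $ Inr k))"

definition block_c :: "int ^ (2 + 2) ^ (2 + 2) \<Rightarrow> complex ^ 2 ^ 2" where
  "block_c \<gamma> = (\<chi> i k. of_int (\<gamma> $ Inr i $ Inl k))"

definition block_d :: "int ^ (2 + 2) ^ (2 + 2) \<Rightarrow> complex ^ 2 ^ 2" where
  "block_d \<gamma> = (\<chi> i k. of_int (\<gamma> $ Inr i $ Inr k))"

definition siegel :: "(complex ^ 2 ^ 2) set" where
  "siegel = {\<tau>. transpose \<tau> = \<tau> \<and>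
     (\<forall>v :: real ^ 2. v \<noteq> 0 \<longrightarrow> 0 < v \<bullet> ((\<chi> i k. Im (\<tau> $ i $ k)) *v v))}"

definition autfac :: "int ^ (2 + 2) ^ (2 + 2) \<Rightarrow> complex ^ 2 ^ 2 \<Rightarrow> complex ^ 2 ^ 2" where
  "autfac \<gamma> \<tau> = block_c \<gamma> ** \<tau> + block_d \<gamma>"

definition act :: "int ^ (2 + 2) ^ (2 + 2) \<Rightarrow> complex ^ 2 ^ 2 \<Rightarrow> complex ^ 2 ^ 2" where
  "act \<gamma> \<tau> = (block_a \<gamma> ** \<tau> + block_b \<gamma>) ** matrix_inv (autfac \<gamma> \<tau>)"


section \<open>Homogeneous polynomials and the representation\<close>

text \<open>Polynomials in \<open>x, y\<close> over the complex numbers are identified with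
  the polynomial functions of the row vector \<open>v = (x, y)\<close>.\<close>

type_synonym bipoly = "complex ^ 2 \<Rightarrow> complex"

definition hom_poly :: "nat \<Rightarrow> (nat \<Rightarrow> complex) \<Rightarrow> bipoly" where
  "hom_poly j a = (\<lambda>v. \<Sum>i\<le>j. a i * (v $ 1) ^ i * (v $ 2) ^ (j - i))"

definition Hom :: "nat \<Rightarrow> bipoly set" where
  "Hom j = range (hom_poly j)"

definition rho :: "nat \<Rightarrow> complex ^ 2 ^ 2 \<Rightarrow> bipoly \<Rightarrow> bipoly" where
  "rho k G p = (\<lambda>v. det G ^ k * p (v v* G))"

definition dx :: "bipoly \<Rightarrow> bipoly" where
  "dx p = (\<lambda>v. deriv (\<lambda>t. p (vector [t, v $ 2])) (v $ 1))"

definition dy :: "bipoly \<Rightarrow> bipoly" where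
  "dy p = (\<lambda>v. deriv (\<lambda>t. p (vector [v $ 1, t])) (v $ 2))"


section \<open>Siegel modular forms\<close>

type_synonym form = "complex ^ 2 ^ 2 \<Rightarrow> bipoly"

definition sym2 :: "complex \<Rightarrow> complex \<Rightarrow> complex \<Rightarrow> complex ^ 2 ^ 2" where
  "sym2 \<tau>1 z \<tau>2 = vector [vector [\<tau>1, z], vector [z, \<tau>2]]"

text \<open>Holomorphy in the three coordinates \<open>\<tau>1, z, \<tau>2\<close>: the (Frechet)
  derivative exists and is complex linear.\<close>

definition siegel_holomorphic :: "(complex ^ 2 ^ 2 \<Rightarrow> complex) \<Rightarrow> bool" where
  "siegel_holomorphic f \<longleftrightarrow> (\<forall>\<tau>\<in>siegel. \<exists>A B C.
     ((\<lambda>(\<tau>1, z, \<tau>2). f (sym2 \<tau>1 z \<tau>2)) has_derivative (\<lambda>(h1, h, h2). A * h1 + B * h + C * h2))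
       (at (\<tau> $ 1 $ 1, \<tau> $ 1 $ 2, \<tau> $ 2 $ 2)))"

text \<open>A function into the finite-dimensional space \<open>Hom j\<close> is holomorphic if
  its coordinates in the monomial basis are. Only values on the half-space matter.\<close>

definition holomorphic_Hom :: "nat \<Rightarrow> form \<Rightarrow> bool" where
  "holomorphic_Hom j F \<longleftrightarrow> (\<exists>a. (\<forall>i\<le>j. siegel_holomorphic (a i)) \<and>
     (\<forall>\<tau>\<in>siegel. F \<tau> = hom_poly j (\<lambda>i. a i \<tau>)))"

definition modular_forms :: "nat \<Rightarrow> nat \<Rightarrow> form set" where
  "modular_forms j k = {F. F \<in> siegel \<rightarrow> Hom j \<and> holomorphic_Hom j F \<and>
     (\<forall>\<gamma>\<in>Sp4Z. \<forall>\<tau>\<in>siegel. F (act \<gamma> \<tau>) = rho k (autfac \<gamma> \<tau>) (F \<tau>))}"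

text \<open>Classical modular forms take values in \<open>Hom 0\<close>, the constant polynomials.\<close>

abbreviation classical_forms :: "nat \<Rightarrow> form set" where
  "classical_forms l \<equiv> modular_forms 0 l"


section \<open>The operators d/d\<tau> and W\<close>

definition d_tau1 :: "form \<Rightarrow> form" where
  "d_tau1 F = (\<lambda>\<tau> v. deriv (\<lambda>t. F (sym2 t (\<tau> $ 1 $ 2) (\<tau> $ 2 $ 2)) v) (\<tau> $ 1 $ 1))"

definition d_z :: "form \<Rightarrow> form" where
  "d_z F = (\<lambda>\<tau> v. deriv (\<lambda>t. F (sym2 (\<tau> $ 1 $ 1) t (\<tau> $ 2 $ 2)) v) (\<tau> $ 1 $ 2))"

definition d_tau2 :: "form \<Rightarrow> form" where
  "d_tau2 F = (\<lambda>\<tau> v. deriv (\<lambda>t. F (sym2 (\<tau> $ 1 $ 1) (\<tau> $ 1 $ 2) t) v) (\<tau> $ 2 $ 2))"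

definition d_dtau :: "(form \<Rightarrow> form) ^ 2 ^ 2" where
  "d_dtau = (\<chi> i k. if i = k then (if i = 1 then d_tau1 else d_tau2)
                    else (\<lambda>F \<tau> v. 1 / 2 * d_z F \<tau> v))"

text \<open>The matrix of functions \<open>d\<phi>/d\<tau>\<close>, each entry regarded as the operator
  of multiplication by it.\<close>

definition mult_d_dtau :: "form \<Rightarrow> (form \<Rightarrow> form) ^ 2 ^ 2" where
  "mult_d_dtau \<phi> = (\<chi> i k. (\<lambda>G \<tau> v. (d_dtau $ i $ k) \<phi> \<tau> v * G \<tau> v))"

text \<open>The \<open>2\<times>2\<close> minors of the last two rows of the determinant
  defining \<open>W\<close>, complementary to the entries \<open>r11\<close>, \<open>r12\<close> and \<open>r22\<close>.\<close>

definition minor11 :: "bipoly \<Rightarrow> bipoly" where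
  "minor11 p = (\<lambda>v. - (v $ 1) * (v $ 2) * dy (dy p) v - (v $ 1)\<^sup>2 * dx (dy p) v)"

definition minor12 :: "bipoly \<Rightarrow> bipoly" where
  "minor12 p = (\<lambda>v. (v $ 2)\<^sup>2 * dy (dy p) v - (v $ 1)\<^sup>2 * dx (dx p) v)"

definition minor22 :: "bipoly \<Rightarrow> bipoly" where
  "minor22 p = (\<lambda>v. (v $ 2)\<^sup>2 * dx (dy p) v - (- (v $ 1) * (v $ 2)) * dx (dx p) v)"

text \<open>Expansion of the determinant along its first row; the entries of \<open>r\<close> are
  operators on polynomial-valued functions of \<open>\<tau>\<close>.\<close>

definition W :: "(form \<Rightarrow> form) ^ 2 ^ 2 \<Rightarrow> form \<Rightarrow> form" where
  "W r F = (\<lambda>\<tau> v. (r $ 1 $ 1) (\<lambda>\<sigma>. minor11 (F \<sigma>)) \<tau> v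
                - (r $ 1 $ 2) (\<lambda>\<sigma>. minor12 (F \<sigma>)) \<tau> v
                + (r $ 2 $ 2) (\<lambda>\<sigma>. minor22 (F \<sigma>)) \<tau> v)"

definition bracket :: "nat \<Rightarrow> nat \<Rightarrow> nat \<Rightarrow> form \<Rightarrow> form \<Rightarrow> form" where
  "bracket j k l F \<phi> = (\<lambda>\<tau> v.
     1 / ((of_nat j - 1) * (2 * of_real pi * \<i>)) *
       ((of_nat k + of_nat j / 2 - 1) * W (mult_d_dtau \<phi>) F \<tau> v
        - of_nat l * \<phi> \<tau> v * W d_dtau F \<tau> v))"

end

theory Submission
  imports Defs
begin

text \<open>
  Write \<open>G = c\<tau> + d\<close>, \<open>u = vG\<close> for a row vector \<open>v = (x, y)\<close>, and \<open>p = F(\<tau>)\<close>.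

  On a homogeneous polynomial \<open>p\<close> of degree \<open>j\<close> the second order operator \<open>W(r)\<close> is
  \<open>j - 1\<close> times a first order one. By Euler's relation for \<open>p\<^sub>x\<close> and \<open>p\<^sub>y\<close>,
  \<open>W(r) p / (j - 1) = - r\<^sub>1\<^sub>1 x p\<^sub>y - r\<^sub>1\<^sub>2 (y p\<^sub>y - x p\<^sub>x) + r\<^sub>2\<^sub>2 y p\<^sub>x\<close>,
  which is the derivative of \<open>p\<close> at \<open>v\<close> along \<open>v r \<epsilon>\<close>, where \<open>\<epsilon>\<close> sends \<open>(s, t)\<close> to \<open>(t, -s)\<close>
  (lemma \<open>minors_hom_poly\<close>). As \<open>G\<^sup>T \<epsilon> G = det G \<cdot> \<epsilon>\<close>, this operation is covariant: replacing \<open>p\<close> by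
  \<open>p(vG)\<close> and \<open>r\<close> by \<open>G r G\<^sup>T\<close> yields \<open>det G\<close> times the original result at \<open>u\<close> (\<open>first_order_W_covariance\<close>). This
  accounts for the extra determinant in the weight \<open>k + l + 1\<close>.

  The derivative \<open>d/d\<tau>\<close> spoils covariance only through the derivative of \<open>G\<close>. The action satisfies
  \<open>d(\<gamma>\<tau>) = G\<^sup>-\<^sup>T d\<tau> G\<^sup>-\<^sup>1\<close>, so a step \<open>G\<^sup>T e G\<close> at \<open>\<tau>\<close> is a step \<open>e\<close> at \<open>\<gamma>\<tau>\<close>
  (\<open>act_sym_line_derivative\<close>). Along it \<open>G\<close> moves by \<open>K e G\<close> with \<open>K = c G\<^sup>T\<close>, which is a symmetric
  matrix. Differentiating \<open>F(\<gamma>\<tau>)(v) = det G\<^sup>k F(\<tau>)(vG)\<close> therefore gives, besides the covariant term,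
  the connection terms \<open>k tr(K e) q\<close> and the derivative of \<open>q\<close> along \<open>v K e\<close>, where \<open>q = F(\<gamma>\<tau>)\<close>
  (\<open>first_order_transformation\<close>). After contraction with \<open>W\<close> the first of these contributes
  \<open>k\<close> and the second, by Euler's relation again, \<open>j/2 - 1\<close> times the same expression
  \<open>W(K) q / (j - 1)\<close> (\<open>first_order_W_dtau_connection\<close>). For \<open>\<phi>\<close> the connection term of \<open>d\<phi>/d\<tau>\<close> is
  \<open>l \<phi> K\<close>. Hence \<open>W(d\<phi>/d\<tau>)F\<close> and \<open>\<phi> W(d/d\<tau>)F\<close> deviate from covariance by
  \<open>l \<phi> W(K) q\<close> and \<open>(k + j/2 - 1) \<phi> W(K) q\<close>, and the bracket is the combination in which the two
  deviations cancel (\<open>bracket_transformation\<close>).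

  Holomorphy of the bracket needs that the partial derivatives of a complex differentiable function
  of three variables are differentiable again. Along each complex direction the derivative is a
  Cauchy integral over a circle; this shows first that it is continuous in the base point, and then
  permits differentiation under the integral sign (\<open>directional_derivative_differentiable\<close>).
\<close>

\<comment> \<open>The symbol is shared with the components of a vector; every nested use would double the number of parses.\<close>
no_notation fps_nth (infixl "$" 75)

section \<open>Iterating partial derivatives of holomorphic functions of several variables\<close>

definition circle_point :: "real \<Rightarrow> real \<Rightarrow> complex" where
  "circle_point r t = of_real r * exp (2 * of_real pi * \<i> * of_real t)"

lemma norm_circle_point [simp]: "norm (circle_point r t) = \<bar>r\<bar>"
  by (simp add: circle_point_def norm_mult)

lemma circle_point_nonzero: "r \<noteq> 0 \<Longrightarrow> circle_point r t \<noteq> 0"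
  by (simp add: circle_point_def)

lemma continuous_on_circle_point [continuous_intros]:
  "continuous_on S g \<Longrightarrow> continuous_on S (\<lambda>x. circle_point r (g x))"
  unfolding circle_point_def by (intro continuous_intros)

text \<open>Cauchy's formula for the first derivative. In the parameter \<open>t\<close> the contour element divided by
  \<open>2\<pi>\<i>\<close> is \<open>circle_point r t dt\<close>, which cancels one of the two factors of the denominator.\<close>
lemma derivative_circle_mean:
  assumes "open S" "cball 0 r \<subseteq> S" "0 < r"
    and der: "\<And>s. s \<in> S \<Longrightarrow> (g has_field_derivative g' s) (at s)"
  shows "g' 0 = integral (cbox 0 1) (\<lambda>t. g (circle_point r t) / circle_point r t)"
proof -
  have hol: "g holomorphic_on S"
    using der assms(1) holomorphic_on_open by blast
  have cont: "continuous_on (cball 0 r) g"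
    using hol assms(2) holomorphic_on_imp_continuous_on continuous_on_subset by blast
  have holb: "g holomorphic_on ball 0 r"
    using hol assms(2) ball_subset_cball by (meson holomorphic_on_subset order_trans)
  have "(g has_field_derivative (1 / (2 * of_real pi * \<i>) *
          contour_integral (circlepath 0 r) (\<lambda>u. g u / (u - 0)^2))) (at 0)"
    using Cauchy_derivative_integral_circlepath(2)[OF cont holb, of 0] assms(3) by simp
  moreover have "(g has_field_derivative g' 0) (at 0)"
    by (intro der) (use assms(2,3) in force)
  ultimately have "g' 0 = 1 / (2 * of_real pi * \<i>) *
          contour_integral (circlepath 0 r) (\<lambda>u. g u / (u - 0)^2)"
    by (rule DERIV_unique[symmetric])
  also have "contour_integral (circlepath 0 r) (\<lambda>u. g u / (u - 0)^2)
      = integral {0..1} (\<lambda>t. 2 * of_real pi * \<i> * (g (circle_point r t) / circle_point r t))"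
    unfolding contour_integral_integral
    by (rule integral_cong)
      (use assms(3) in \<open>simp only: vector_derivative_circlepath,
        simp add: circlepath circle_point_def power2_eq_square\<close>)
  also have "\<dots> = 2 * of_real pi * \<i> * integral {0..1} (\<lambda>t. g (circle_point r t) / circle_point r t)"
    by (rule integral_mult_right)
  finally show ?thesis by simp
qed

text \<open>Here and below \<open>cs\<close> is the multiplication by complex scalars on a real vector space,
  so that complex linearity and complex lines can be expressed for any Euclidean space. A common
  radius for all base points near \<open>x\<close> is what makes the circle integrals depend on a parameter while
  their domain of integration stays fixed.\<close>
lemma uniform_disc_radius:
  fixes cs :: "complex \<Rightarrow> 'a::real_normed_vector \<Rightarrow> 'a"
  assumes "bounded_bilinear cs" "open U" "x \<in> U"
  obtains r d where "0 < r" "0 < d"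
    "\<And>y s. y \<in> ball x d \<Longrightarrow> norm s \<le> r \<Longrightarrow> y + cs s e \<in> U"
proof -
  interpret bounded_bilinear cs by fact
  have "isCont (\<lambda>p. fst p + cs (snd p) e) (x, 0)"
    by (intro continuous_intros bounded_linear.continuous[OF bounded_linear_left])
  then have "\<forall>\<^sub>F p in nhds (x, 0). fst p + cs (snd p) e \<in> U"
    using assms(2,3) unfolding isCont_def tendsto_def
    by (auto simp: zero_left eventually_nhds_conv_at)
  then obtain V where V: "open V" "(x, 0) \<in> V" "\<And>p. p \<in> V \<Longrightarrow> fst p + cs (snd p) e \<in> U"
    unfolding eventually_nhds by blast
  obtain A B where AB: "open A" "open B" "(x, 0) \<in> A \<times> B" "A \<times> B \<subseteq> V"
    using V open_prod_elim by metis
  obtain d where d: "0 < d" "ball x d \<subseteq> A"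
    using AB openE by blast
  obtain r where r: "0 < r" "cball 0 r \<subseteq> B"
    using AB by (meson mem_Sigma_iff open_contains_cball)
  show ?thesis
    by (rule that[OF r(1) d(1)]) (use AB(4) V(3) r d in fastforce)
qed

text \<open>Complex linearity of \<open>f' y\<close> turns \<open>f\<close> restricted to a complex line into a holomorphic function of
  one variable.\<close>
lemma directional_derivative_circle_mean:
  fixes cs :: "complex \<Rightarrow> 'a::euclidean_space \<Rightarrow> 'a"
  assumes "bounded_bilinear cs" "open U"
    and der: "\<And>y. y \<in> U \<Longrightarrow> (f has_derivative f' y) (at y)"
    and lin: "\<And>y s h. y \<in> U \<Longrightarrow> f' y (cs s h) = s * f' y h"
    and "0 < r" and disc: "\<And>s. norm s \<le> r \<Longrightarrow> x + cs s e \<in> U"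
  shows "f' x e = integral (cbox 0 1) (\<lambda>t. f (x + cs (circle_point r t) e) / circle_point r t)"
proof -
  interpret bounded_bilinear cs by fact
  define S where "S = (\<lambda>s. x + cs s e) -` U"
  have 0: "continuous_on UNIV (\<lambda>s. x + cs s e)"
    by (intro continuous_intros bounded_linear.continuous_on[OF bounded_linear_left])
  have "open S"
    unfolding S_def using 0 assms(2) by (metis open_vimage)
  moreover have "cball 0 r \<subseteq> S"
    using disc by (auto simp: S_def)
  moreover have "((\<lambda>s. f (x + cs s e)) has_field_derivative f' (x + cs s e) e) (at s)"
    if "s \<in> S" for s
  proof -
    have "((\<lambda>s. x + cs s e) has_derivative (\<lambda>t. cs t e)) (at s)"
      by (auto intro!: derivative_eq_intros bounded_linear.has_derivative[OF bounded_linear_left])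
    then have "(f \<circ> (\<lambda>s. x + cs s e) has_derivative f' (x + cs s e) \<circ> (\<lambda>t. cs t e)) (at s)"
      using that by (intro diff_chain_at der) (auto simp: S_def)
    moreover have "f' (x + cs s e) \<circ> (\<lambda>t. cs t e) = (*) (f' (x + cs s e) e)"
      using that lin by (auto simp: S_def fun_eq_iff mult.commute)
    ultimately show ?thesis
      by (simp add: has_field_derivative_def o_def)
  qed
  ultimately show ?thesis
    using derivative_circle_mean[of S r "\<lambda>s. f (x + cs s e)" "\<lambda>s. f' (x + cs s e) e"] assms(5)
    by (simp add: zero_left)
qed

text \<open>The derivative inherits continuity from \<open>f\<close>, because the circle integral is continuous in its
  parameter.\<close>
lemma continuous_on_directional_derivative:
  fixes cs :: "complex \<Rightarrow> 'a::euclidean_space \<Rightarrow> 'a"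
  assumes bil: "bounded_bilinear cs" and "open U"
    and der: "\<And>y. y \<in> U \<Longrightarrow> (f has_derivative f' y) (at y)"
    and lin: "\<And>y s h. y \<in> U \<Longrightarrow> f' y (cs s h) = s * f' y h"
  shows "continuous_on U (\<lambda>x. f' x e)"
proof -
  interpret bounded_bilinear cs by fact
  have contf: "continuous_on U f"
    using der has_derivative_continuous continuous_at_imp_continuous_on by blast
  have "isCont (\<lambda>x. f' x e) x" if x: "x \<in> U" for x
  proof -
    obtain r d where rd: "0 < r" "0 < d"
      "\<And>y s. y \<in> ball x d \<Longrightarrow> norm s \<le> r \<Longrightarrow> y + cs s e \<in> U"
      using uniform_disc_radius[OF bil \<open>open U\<close> x, of e] by metis
    have "continuous_on (ball x d \<times> cbox 0 1) (\<lambda>(y, t). f (y + cs (circle_point r t) e) / circle_point r t)"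
      unfolding split_beta
    proof (intro continuous_intros continuous_on_compose2[OF contf]
        bounded_linear.continuous_on[OF bounded_linear_left])
      show "(\<lambda>p. fst p + cs (circle_point r (snd p)) e) ` (ball x d \<times> cbox 0 1) \<subseteq> U"
        using rd by auto
    qed (use rd in \<open>auto simp: circle_point_nonzero\<close>)
    from integral_continuous_on_param[OF this]
    have "continuous_on (ball x d)
        (\<lambda>y. integral (cbox 0 1) (\<lambda>t. f (y + cs (circle_point r t) e) / circle_point r t))" .
    also have "?this \<longleftrightarrow> continuous_on (ball x d) (\<lambda>y. f' y e)"
      by (intro continuous_on_cong refl
          directional_derivative_circle_mean[OF bil \<open>open U\<close> der lin, symmetric]) (use rd in auto)
    finally show ?thesis
      using rd(2) by (simp add: continuous_on_eq_continuous_at)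
  qed
  then show ?thesis
    by (simp add: continuous_at_imp_continuous_on)
qed

text \<open>The circle integral may be differentiated under the integral sign, since by the previous lemma
  the derivative of its integrand is continuous in every direction and hence, in finite dimension,
  in the operator norm. Complex linearity of the integrand's derivative passes to the integral.\<close>
lemma directional_derivative_differentiable:
  fixes cs :: "complex \<Rightarrow> 'a::euclidean_space \<Rightarrow> 'a"
  assumes bil: "bounded_bilinear cs" and "open U"
    and der: "\<And>y. y \<in> U \<Longrightarrow> (f has_derivative f' y) (at y)"
    and lin: "\<And>y s h. y \<in> U \<Longrightarrow> f' y (cs s h) = s * f' y h"
    and x: "x \<in> U"
  shows "\<exists>D. ((\<lambda>y. f' y e) has_derivative D) (at x) \<and> (\<forall>s h. D (cs s h) = s * D h)"
proof -
  interpret bounded_bilinear cs by fact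
  have contf: "continuous_on U f"
    using der has_derivative_continuous continuous_at_imp_continuous_on by blast
  obtain r d where rd: "0 < r" "0 < d"
    "\<And>y s. y \<in> ball x d \<Longrightarrow> norm s \<le> r \<Longrightarrow> y + cs s e \<in> U"
    using uniform_disc_radius[OF bil \<open>open U\<close> x, of e] by metis
  define K where "K y t = Blinfun (\<lambda>h. f' (y + cs (circle_point r t) e) h / circle_point r t)" for y t
  have inU: "y + cs (circle_point r t) e \<in> U" if "y \<in> ball x d" for y t
    using that rd by auto
  have K: "blinfun_apply (K y t) = (\<lambda>h. f' (y + cs (circle_point r t) e) h / circle_point r t)"
    if "y \<in> ball x d" for y t
  proof -
    have "bounded_linear (f' (y + cs (circle_point r t) e))"
      using der[OF inU[OF that]] has_derivative_bounded_linear by blast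
    then show ?thesis
      unfolding K_def
      by (intro bounded_linear_Blinfun_apply bounded_linear_compose[OF bounded_linear_divide])
  qed
  have contK: "continuous_on (ball x d \<times> cbox 0 1) (\<lambda>(y, t). K y t)"
  proof (rule continuous_on_blinfun_componentwise)
    fix i :: 'a
    have "continuous_on (ball x d \<times> cbox 0 1)
        (\<lambda>p. f' (fst p + cs (circle_point r (snd p)) e) i / circle_point r (snd p))"
    proof (intro continuous_intros
        continuous_on_compose2[OF continuous_on_directional_derivative[OF bil \<open>open U\<close> der lin]]
        bounded_linear.continuous_on[OF bounded_linear_left])
      show "(\<lambda>p. fst p + cs (circle_point r (snd p)) e) ` (ball x d \<times> cbox 0 1) \<subseteq> U"
        using rd by auto
    qed (use rd in \<open>auto simp: circle_point_nonzero\<close>)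
    then show "continuous_on (ball x d \<times> cbox 0 1) (\<lambda>p. blinfun_apply (case p of (y, t) \<Rightarrow> K y t) i)"
      by (rule continuous_on_eq) (auto simp: K)
  qed
  have "((\<lambda>y. integral (cbox 0 1) (\<lambda>t. f (y + cs (circle_point r t) e) / circle_point r t))
      has_derivative integral (cbox 0 1) (K x)) (at x within ball x d)"
  proof (rule leibniz_rule[OF _ _ contK])
    fix y t assume y: "y \<in> ball x d"
    have "((\<lambda>y. y + cs (circle_point r t) e) has_derivative (\<lambda>h. h)) (at y)"
      by (auto intro!: derivative_eq_intros)
    from diff_chain_at[OF this der[OF inU[OF y]]]
    have "((\<lambda>y. f (y + cs (circle_point r t) e)) has_derivative f' (y + cs (circle_point r t) e)) (at y)"
      by (simp add: o_def)
    from bounded_linear.has_derivative[OF bounded_linear_divide this]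
    have "((\<lambda>y. f (y + cs (circle_point r t) e) / circle_point r t) has_derivative
        (\<lambda>h. f' (y + cs (circle_point r t) e) h / circle_point r t)) (at y)" .
    then show "((\<lambda>y. f (y + cs (circle_point r t) e) / circle_point r t) has_derivative
        blinfun_apply (K y t)) (at y within ball x d)"
      unfolding K[OF y] by (rule has_derivative_at_withinI)
  next
    fix y assume y: "y \<in> ball x d"
    show "(\<lambda>t. f (y + cs (circle_point r t) e) / circle_point r t) integrable_on cbox 0 1"
      by (intro integrable_continuous continuous_intros continuous_on_compose2[OF contf]
         bounded_linear.continuous_on[OF bounded_linear_left])
        (use rd y in \<open>auto simp: circle_point_nonzero\<close>)
  qed (use rd in auto)
  then have 1: "((\<lambda>y. integral (cbox 0 1) (\<lambda>t. f (y + cs (circle_point r t) e) / circle_point r t))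
      has_derivative integral (cbox 0 1) (K x)) (at x)"
    using rd at_within_open[of x "ball x d"] by simp
  have "((\<lambda>y. f' y e) has_derivative integral (cbox 0 1) (K x)) (at x)"
  proof (rule has_derivative_transform_within_open[OF 1, of "ball x d"])
    fix y assume "y \<in> ball x d"
    then show "integral (cbox 0 1) (\<lambda>t. f (y + cs (circle_point r t) e) / circle_point r t) = f' y e"
      by (intro directional_derivative_circle_mean[OF bil \<open>open U\<close> der lin, symmetric] rd)
  qed (use rd in auto)
  moreover have "blinfun_apply (integral (cbox 0 1) (K x)) (cs s h)
      = s * blinfun_apply (integral (cbox 0 1) (K x)) h" for s h
  proof -
    have Kx: "blinfun_apply (K x t) = (\<lambda>h. f' (x + cs (circle_point r t) e) h / circle_point r t)" for t
      by (rule K) (use rd in simp)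
    have lin': "f' (x + cs (circle_point r t) e) (cs s h) = s * f' (x + cs (circle_point r t) e) h" for t
      by (intro lin inU) (use rd in auto)
    have "continuous_on (cbox 0 1) (\<lambda>t. (\<lambda>(y, t). K y t) (x, t))"
      by (rule continuous_on_compose2[OF contK]) (use rd in \<open>auto intro!: continuous_intros\<close>)
    then have "K x integrable_on cbox 0 1"
      by (intro integrable_continuous) simp
    then show ?thesis
      by (simp only: blinfun_apply_integral Kx lin' times_divide_eq_right[symmetric]
          integral_mult_right)
  qed
  ultimately show ?thesis
    by blast
qed

section \<open>Holomorphic functions on the Siegel half-space\<close>

text \<open>Positivity of the imaginary part in terms of minors, from which openness in the three coordinates
  can be read off.\<close>
lemma siegel_iff:
  "\<tau> \<in> siegel \<longleftrightarrow> \<tau> $ 2 $ 1 = \<tau> $ 1 $ 2 \<and> 0 < Im (\<tau> $ 1 $ 1) \<and>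
     (Im (\<tau> $ 1 $ 2))\<^sup>2 < Im (\<tau> $ 1 $ 1) * Im (\<tau> $ 2 $ 2)"
proof -
  define Q where "Q x y = Im (\<tau> $ 1 $ 1) * x\<^sup>2 +
      (Im (\<tau> $ 1 $ 2) + Im (\<tau> $ 2 $ 1)) * (x * y) + Im (\<tau> $ 2 $ 2) * y\<^sup>2"
    for x y :: real
  have Q: "v \<bullet> ((\<chi> i k. Im (\<tau> $ i $ k)) *v v) = Q (v $ 1) (v $ 2)" for v
    by (simp add: Q_def inner_vec_def matrix_vector_mult_def sum_2 algebra_simps power2_eq_square)
  have sym: "transpose \<tau> = \<tau> \<longleftrightarrow> \<tau> $ 2 $ 1 = \<tau> $ 1 $ 2"
    by (auto simp: transpose_def vec_eq_iff forall_2)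
  have pos: "(\<forall>x y. x \<noteq> 0 \<or> y \<noteq> 0 \<longrightarrow> 0 < Q x y) \<longleftrightarrow> 0 < Im (\<tau> $ 1 $ 1) \<and>
     (Im (\<tau> $ 1 $ 2))\<^sup>2 < Im (\<tau> $ 1 $ 1) * Im (\<tau> $ 2 $ 2)" (is "?L \<longleftrightarrow> ?R")
    if s: "\<tau> $ 2 $ 1 = \<tau> $ 1 $ 2"
  proof
    assume L: ?L
    have 1: "0 < Im (\<tau> $ 1 $ 1)"
      using L[rule_format, of 1 0] by (simp add: Q_def)
    have "0 < Q (- Im (\<tau> $ 1 $ 2)) (Im (\<tau> $ 1 $ 1))"
      using 1 by (intro L[rule_format]) auto
    also have "\<dots> = Im (\<tau> $ 1 $ 1) * (Im (\<tau> $ 1 $ 1) * Im (\<tau> $ 2 $ 2) - (Im (\<tau> $ 1 $ 2))\<^sup>2)"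
      using s by (simp add: Q_def algebra_simps power2_eq_square)
    finally show ?R
      using 1 by (simp add: zero_less_mult_iff)
  next
    assume R: ?R
    show ?L
    proof (intro allI impI)
      fix x y :: real assume xy: "x \<noteq> 0 \<or> y \<noteq> 0"
      have eq: "Im (\<tau> $ 1 $ 1) * Q x y = (Im (\<tau> $ 1 $ 1) * x + Im (\<tau> $ 1 $ 2) * y)\<^sup>2 +
          (Im (\<tau> $ 1 $ 1) * Im (\<tau> $ 2 $ 2) - (Im (\<tau> $ 1 $ 2))\<^sup>2) * y\<^sup>2"
        using s by (simp add: Q_def algebra_simps power2_eq_square)
      have "0 < Im (\<tau> $ 1 $ 1) * Q x y"
      proof (cases "y = 0")
        case True
        then show ?thesis using R xy unfolding eq by simp
      next
        case False
        then show ?thesis using R unfolding eq by (intro add_nonneg_pos mult_pos_pos) auto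
      qed
      then show "0 < Q x y"
        using R by (simp add: zero_less_mult_iff)
    qed
  qed
  have "(\<forall>v::real^2. v \<noteq> 0 \<longrightarrow> 0 < Q (v $ 1) (v $ 2)) \<longleftrightarrow> (\<forall>x y. x \<noteq> 0 \<or> y \<noteq> 0 \<longrightarrow> 0 < Q x y)"
    by (simp add: forall_vector_2 vec_eq_iff forall_2 del: One_nat_def)
  then show ?thesis
    unfolding siegel_def mem_Collect_eq Q sym using pos by blast
qed

lemma sym2_nth [simp]:
  "sym2 a b c $ 1 $ 1 = a" "sym2 a b c $ 1 $ 2 = b" "sym2 a b c $ 2 $ 1 = b" "sym2 a b c $ 2 $ 2 = c"
  by (simp_all add: sym2_def)

lemma sym2_siegel: "\<tau> \<in> siegel \<Longrightarrow> sym2 (\<tau> $ 1 $ 1) (\<tau> $ 1 $ 2) (\<tau> $ 2 $ 2) = \<tau>"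
  by (simp add: siegel_iff vec_eq_iff forall_2)

definition siegel_coords :: "(complex \<times> complex \<times> complex) set" where
  "siegel_coords = {(a, b, c). sym2 a b c \<in> siegel}"

lemma open_siegel_coords: "open siegel_coords"
proof -
  have "siegel_coords = {p. 0 < Im (fst p) \<and> (Im (fst (snd p)))\<^sup>2 < Im (fst p) * Im (snd (snd p))}"
    by (auto simp: siegel_coords_def siegel_iff)
  also have "open \<dots>"
    by (intro open_Collect_conj open_Collect_less continuous_intros)
  finally show ?thesis .
qed

text \<open>\<open>B\<close> is the derivative with respect to the variable \<open>z\<close>, which occupies both off-diagonal entries;
  the entry of the matrix derivative \<open>d/d\<tau>\<close> is half of it.\<close>
definition has_siegel_derivative ::
  "(complex ^ 2 ^ 2 \<Rightarrow> complex) \<Rightarrow> complex ^ 2 ^ 2 \<Rightarrow> complex \<Rightarrow> complex \<Rightarrow> complex \<Rightarrow> bool" where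
  "has_siegel_derivative f \<tau> A B C \<longleftrightarrow>
     ((\<lambda>(\<tau>1, z, \<tau>2). f (sym2 \<tau>1 z \<tau>2)) has_derivative (\<lambda>(h1, h, h2). A * h1 + B * h + C * h2))
       (at (\<tau> $ 1 $ 1, \<tau> $ 1 $ 2, \<tau> $ 2 $ 2))"

definition partial1 :: "(complex ^ 2 ^ 2 \<Rightarrow> complex) \<Rightarrow> complex ^ 2 ^ 2 \<Rightarrow> complex" where
  "partial1 f \<tau> = deriv (\<lambda>t. f (sym2 t (\<tau> $ 1 $ 2) (\<tau> $ 2 $ 2))) (\<tau> $ 1 $ 1)"

definition partialz :: "(complex ^ 2 ^ 2 \<Rightarrow> complex) \<Rightarrow> complex ^ 2 ^ 2 \<Rightarrow> complex" where
  "partialz f \<tau> = deriv (\<lambda>t. f (sym2 (\<tau> $ 1 $ 1) t (\<tau> $ 2 $ 2))) (\<tau> $ 1 $ 2)"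

definition partial2 :: "(complex ^ 2 ^ 2 \<Rightarrow> complex) \<Rightarrow> complex ^ 2 ^ 2 \<Rightarrow> complex" where
  "partial2 f \<tau> = deriv (\<lambda>t. f (sym2 (\<tau> $ 1 $ 1) (\<tau> $ 1 $ 2) t)) (\<tau> $ 2 $ 2)"

lemma has_siegel_derivative_chain:
  assumes "has_siegel_derivative f (sym2 (n1 t) (n t) (n2 t)) A B C"
    and "(n1 has_field_derivative h1) (at t)" "(n has_field_derivative h) (at t)"
        "(n2 has_field_derivative h2) (at t)"
  shows "((\<lambda>t. f (sym2 (n1 t) (n t) (n2 t))) has_field_derivative A * h1 + B * h + C * h2) (at t)"
proof -
  have "((\<lambda>t. (n1 t, n t, n2 t)) has_derivative (\<lambda>s. (h1 * s, h * s, h2 * s))) (at t)"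
    using assms(2-4) unfolding has_field_derivative_def by (intro has_derivative_Pair)
  then have "((\<lambda>(a, b, c). f (sym2 a b c)) \<circ> (\<lambda>t. (n1 t, n t, n2 t)) has_derivative
      (\<lambda>(h1, h, h2). A * h1 + B * h + C * h2) \<circ> (\<lambda>s. (h1 * s, h * s, h2 * s))) (at t)"
    using assms(1) unfolding has_siegel_derivative_def
    by (intro diff_chain_at) simp_all
  moreover have "(\<lambda>(h1, h, h2). A * h1 + B * h + C * h2) \<circ> (\<lambda>s. (h1 * s, h * s, h2 * s))
      = (*) (A * h1 + B * h + C * h2)"
    by (auto simp: fun_eq_iff algebra_simps)
  ultimately show ?thesis
    by (simp add: has_field_derivative_def o_def)
qed

lemma has_siegel_derivative_unique:
  assumes "has_siegel_derivative f \<tau> A B C"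
  shows "partial1 f \<tau> = A" "partialz f \<tau> = B" "partial2 f \<tau> = C"
proof -
  note c = has_siegel_derivative_chain[where f = f and A = A and B = B and C = C]
  have s: "has_siegel_derivative f (sym2 (\<tau> $ 1 $ 1) (\<tau> $ 1 $ 2) (\<tau> $ 2 $ 2)) A B C"
    using assms by (simp add: has_siegel_derivative_def)
  show "partial1 f \<tau> = A"
    unfolding partial1_def using c[of "\<lambda>t. t" "\<tau> $ 1 $ 1" "\<lambda>t. \<tau> $ 1 $ 2" "\<lambda>t. \<tau> $ 2 $ 2" 1 0 0] s
    by (intro DERIV_imp_deriv) simp
  show "partialz f \<tau> = B"
    unfolding partialz_def using c[of "\<lambda>t. \<tau> $ 1 $ 1" "\<tau> $ 1 $ 2" "\<lambda>t. t" "\<lambda>t. \<tau> $ 2 $ 2" 0 1 0] s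
    by (intro DERIV_imp_deriv) simp
  show "partial2 f \<tau> = C"
    unfolding partial2_def using c[of "\<lambda>t. \<tau> $ 1 $ 1" "\<tau> $ 2 $ 2" "\<lambda>t. \<tau> $ 1 $ 2" "\<lambda>t. t" 0 0 1] s
    by (intro DERIV_imp_deriv) simp
qed

lemma siegel_holomorphic_derivative:
  "siegel_holomorphic f \<Longrightarrow> \<tau> \<in> siegel \<Longrightarrow>
     has_siegel_derivative f \<tau> (partial1 f \<tau>) (partialz f \<tau>) (partial2 f \<tau>)"
  unfolding siegel_holomorphic_def has_siegel_derivative_def[symmetric]
  using has_siegel_derivative_unique by metis

lemma siegel_holomorphicI:
  "(\<And>\<tau>. \<tau> \<in> siegel \<Longrightarrow> has_siegel_derivative f \<tau> (A \<tau>) (B \<tau>) (C \<tau>)) \<Longrightarrow> siegel_holomorphic f"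
  unfolding siegel_holomorphic_def has_siegel_derivative_def by blast

lemma has_siegel_derivative_const: "has_siegel_derivative (\<lambda>\<tau>. c) \<tau> 0 0 0"
  by (simp add: has_siegel_derivative_def case_prod_unfold)

lemma has_siegel_derivative_add:
  assumes "has_siegel_derivative f \<tau> A B C" "has_siegel_derivative g \<tau> A' B' C'"
  shows "has_siegel_derivative (\<lambda>\<tau>. f \<tau> + g \<tau>) \<tau> (A + A') (B + B') (C + C')"
  using has_derivative_add[OF assms[unfolded has_siegel_derivative_def]]
  by (simp add: has_siegel_derivative_def case_prod_unfold algebra_simps)

lemma has_siegel_derivative_mult:
  assumes "has_siegel_derivative f \<tau> A B C" "has_siegel_derivative g \<tau> A' B' C'"
    and "\<tau> \<in> siegel"
  shows "has_siegel_derivative (\<lambda>\<tau>. f \<tau> * g \<tau>) \<tau>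
      (f \<tau> * A' + A * g \<tau>) (f \<tau> * B' + B * g \<tau>) (f \<tau> * C' + C * g \<tau>)"
  using has_derivative_mult[OF assms(1,2)[unfolded has_siegel_derivative_def]]
  by (simp add: has_siegel_derivative_def case_prod_unfold algebra_simps sym2_siegel[OF assms(3)])

lemma has_siegel_derivative_sum:
  assumes "finite I" "\<And>i. i \<in> I \<Longrightarrow> has_siegel_derivative (f i) \<tau> (A i) (B i) (C i)"
  shows "has_siegel_derivative (\<lambda>\<tau>. \<Sum>i\<in>I. f i \<tau>) \<tau> (\<Sum>i\<in>I. A i) (\<Sum>i\<in>I. B i) (\<Sum>i\<in>I. C i)"
  using assms by (induction I) (simp_all add: has_siegel_derivative_const has_siegel_derivative_add)

lemma siegel_holomorphic_const: "siegel_holomorphic (\<lambda>\<tau>. c)"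
  by (rule siegel_holomorphicI, rule has_siegel_derivative_const)

lemma siegel_holomorphic_add:
  "siegel_holomorphic f \<Longrightarrow> siegel_holomorphic g \<Longrightarrow> siegel_holomorphic (\<lambda>\<tau>. f \<tau> + g \<tau>)"
  by (rule siegel_holomorphicI, rule has_siegel_derivative_add) (auto intro: siegel_holomorphic_derivative)

lemma siegel_holomorphic_mult:
  "siegel_holomorphic f \<Longrightarrow> siegel_holomorphic g \<Longrightarrow> siegel_holomorphic (\<lambda>\<tau>. f \<tau> * g \<tau>)"
  by (rule siegel_holomorphicI, rule has_siegel_derivative_mult) (auto intro: siegel_holomorphic_derivative)

lemma siegel_holomorphic_uminus:
  "siegel_holomorphic f \<Longrightarrow> siegel_holomorphic (\<lambda>\<tau>. - f \<tau>)"
  using siegel_holomorphic_mult[OF siegel_holomorphic_const[of "-1"]] by simp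

lemma siegel_holomorphic_diff:
  "siegel_holomorphic f \<Longrightarrow> siegel_holomorphic g \<Longrightarrow> siegel_holomorphic (\<lambda>\<tau>. f \<tau> - g \<tau>)"
  using siegel_holomorphic_add[OF _ siegel_holomorphic_uminus] by simp

definition coord_scale :: "complex \<Rightarrow> complex \<times> complex \<times> complex \<Rightarrow> complex \<times> complex \<times> complex" where
  "coord_scale s = (\<lambda>(a, b, c). (s * a, s * b, s * c))"

lemma norm_coord_scale: "norm (coord_scale s h) = norm s * norm h"
proof -
  obtain a b c where h: "h = (a, b, c)" by (cases h)
  have "(norm (coord_scale s h))\<^sup>2 = (norm s * norm h)\<^sup>2"
    by (simp add: h coord_scale_def norm_Pair norm_mult power_mult_distrib distrib_left)
  then show ?thesis
    by (simp add: power2_eq_iff_nonneg)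
qed

lemma bounded_bilinear_coord_scale: "bounded_bilinear coord_scale"
proof
  show "\<exists>K. \<forall>s h. norm (coord_scale s h) \<le> norm s * norm h * K"
    by (rule exI[of _ 1]) (simp add: norm_coord_scale)
qed (simp_all add: coord_scale_def case_prod_unfold distrib_left distrib_right)

text \<open>The derivative of a holomorphic function in the coordinate directions, by
  \<open>directional_derivative_differentiable\<close> for the coordinate space of complex triples.\<close>
lemma siegel_holomorphic_partial:
  assumes f: "siegel_holomorphic f"
  shows "siegel_holomorphic (partial1 f)" "siegel_holomorphic (partialz f)" "siegel_holomorphic (partial2 f)"
proof -
  define g where "g = (\<lambda>(a, b, c). f (sym2 a b c))"
  define g' where "g' = (\<lambda>(a, b, c) (h1, h, h2). partial1 f (sym2 a b c) * h1
      + partialz f (sym2 a b c) * h + partial2 f (sym2 a b c) * h2)"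
  have der: "(g has_derivative g' p) (at p)" if "p \<in> siegel_coords" for p
  proof -
    obtain a b c where p: "p = (a, b, c)" by (cases p)
    then show ?thesis
      using that siegel_holomorphic_derivative[OF f, of "sym2 a b c"]
      by (simp add: siegel_coords_def g_def g'_def has_siegel_derivative_def)
  qed
  have lin: "g' p (coord_scale s h) = s * g' p h" if "p \<in> siegel_coords" for p s h
    by (auto simp: g'_def coord_scale_def algebra_simps split: prod.splits)
  have key: "\<exists>A B C. has_siegel_derivative (\<lambda>\<tau>. g' (\<tau> $ 1 $ 1, \<tau> $ 1 $ 2, \<tau> $ 2 $ 2) e) \<tau> A B C"
    if "\<tau> \<in> siegel" for \<tau> e
  proof -
    have p: "(\<tau> $ 1 $ 1, \<tau> $ 1 $ 2, \<tau> $ 2 $ 2) \<in> siegel_coords"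
      using that by (simp add: siegel_coords_def sym2_siegel)
    have "\<exists>D. ((\<lambda>p. g' p e) has_derivative D) (at (\<tau> $ 1 $ 1, \<tau> $ 1 $ 2, \<tau> $ 2 $ 2)) \<and>
        (\<forall>s h. D (coord_scale s h) = s * D h)"
      by (rule directional_derivative_differentiable[OF bounded_bilinear_coord_scale
            open_siegel_coords der lin p])
    then obtain D where D: "((\<lambda>p. g' p e) has_derivative D) (at (\<tau> $ 1 $ 1, \<tau> $ 1 $ 2, \<tau> $ 2 $ 2))"
      "\<forall>s h. D (coord_scale s h) = s * D h"
      by (elim exE conjE)
    interpret D: linear D
      by (rule has_derivative_linear[OF D(1)])
    \<comment> \<open>The derivative is determined by its values on the coordinate vectors.\<close>
    define A B C where ABC: "A = D (1, 0, 0)" "B = D (0, 1, 0)" "C = D (0, 0, 1)"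
    have "D (h1, h, h2) = A * h1 + B * h + C * h2" for h1 h h2
    proof -
      have "(h1, h, h2) = coord_scale h1 (1, 0, 0) + coord_scale h (0, 1, 0) + coord_scale h2 (0, 0, 1)"
        by (simp add: coord_scale_def)
      then show ?thesis
        unfolding ABC by (simp only: D.add D(2)[rule_format] mult.commute)
    qed
    then have "D = (\<lambda>(h1, h, h2). A * h1 + B * h + C * h2)"
      by (auto simp: fun_eq_iff)
    with D(1) show ?thesis
      unfolding has_siegel_derivative_def case_prod_unfold by auto
  qed
  have hol: "siegel_holomorphic f'"
    if "\<And>\<tau>. \<tau> \<in> siegel \<Longrightarrow> \<exists>A B C. has_siegel_derivative f' \<tau> A B C" for f'
    using that unfolding siegel_holomorphic_def has_siegel_derivative_def[symmetric] by (intro ballI)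
  show "siegel_holomorphic (partial1 f)"
  proof (rule hol)
    fix \<tau> :: "complex ^ 2 ^ 2" assume "\<tau> \<in> siegel"
    from key[OF this, of "(1, 0, 0)"] show "\<exists>A B C. has_siegel_derivative (partial1 f) \<tau> A B C"
      by (simp add: has_siegel_derivative_def g'_def)
  qed
  show "siegel_holomorphic (partialz f)"
  proof (rule hol)
    fix \<tau> :: "complex ^ 2 ^ 2" assume "\<tau> \<in> siegel"
    from key[OF this, of "(0, 1, 0)"] show "\<exists>A B C. has_siegel_derivative (partialz f) \<tau> A B C"
      by (simp add: has_siegel_derivative_def g'_def)
  qed
  show "siegel_holomorphic (partial2 f)"
  proof (rule hol)
    fix \<tau> :: "complex ^ 2 ^ 2" assume "\<tau> \<in> siegel"
    from key[OF this, of "(0, 0, 1)"] show "\<exists>A B C. has_siegel_derivative (partial2 f) \<tau> A B C"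
      by (simp add: has_siegel_derivative_def g'_def)
  qed
qed

lemma eventually_siegel_path:
  assumes "isCont n1 t" "isCont n t" "isCont n2 t" "sym2 (n1 t) (n t) (n2 t) \<in> siegel"
  shows "\<forall>\<^sub>F s in nhds t. sym2 (n1 s) (n s) (n2 s) \<in> siegel"
proof -
  have "isCont (\<lambda>s. (n1 s, n s, n2 s)) t"
    by (intro continuous_intros assms)
  then have "\<forall>\<^sub>F s in nhds t. (n1 s, n s, n2 s) \<in> siegel_coords"
    using open_siegel_coords assms(4) unfolding isCont_def tendsto_def
    by (auto simp: siegel_coords_def eventually_nhds_conv_at)
  then show ?thesis
    by (simp add: siegel_coords_def)
qed

text \<open>Partial derivatives on the half-space see only values on the half-space, because it is open in the
  coordinates. This matters since a modular form is arbitrary outside.\<close>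
lemma partial_cong:
  assumes "\<And>\<sigma>. \<sigma> \<in> siegel \<Longrightarrow> f \<sigma> = g \<sigma>" "\<tau> \<in> siegel"
  shows "partial1 f \<tau> = partial1 g \<tau>" "partialz f \<tau> = partialz g \<tau>" "partial2 f \<tau> = partial2 g \<tau>"
proof -
  have s: "sym2 (\<tau> $ 1 $ 1) (\<tau> $ 1 $ 2) (\<tau> $ 2 $ 2) \<in> siegel"
    using assms(2) by (simp add: sym2_siegel)
  show "partial1 f \<tau> = partial1 g \<tau>"
  proof -
    have "\<forall>\<^sub>F t in nhds (\<tau> $ 1 $ 1). sym2 t (\<tau> $ 1 $ 2) (\<tau> $ 2 $ 2) \<in> siegel"
      by (rule eventually_siegel_path) (simp_all add: s)
    then have "\<forall>\<^sub>F t in nhds (\<tau> $ 1 $ 1). f (sym2 t (\<tau> $ 1 $ 2) (\<tau> $ 2 $ 2)) = g (sym2 t (\<tau> $ 1 $ 2) (\<tau> $ 2 $ 2))"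
      by eventually_elim (rule assms(1))
    then show ?thesis
      unfolding partial1_def by (intro deriv_cong_ev refl)
  qed
  show "partialz f \<tau> = partialz g \<tau>"
  proof -
    have "\<forall>\<^sub>F t in nhds (\<tau> $ 1 $ 2). sym2 (\<tau> $ 1 $ 1) t (\<tau> $ 2 $ 2) \<in> siegel"
      by (rule eventually_siegel_path) (simp_all add: s)
    then have "\<forall>\<^sub>F t in nhds (\<tau> $ 1 $ 2). f (sym2 (\<tau> $ 1 $ 1) t (\<tau> $ 2 $ 2)) = g (sym2 (\<tau> $ 1 $ 1) t (\<tau> $ 2 $ 2))"
      by eventually_elim (rule assms(1))
    then show ?thesis
      unfolding partialz_def by (intro deriv_cong_ev refl)
  qed
  show "partial2 f \<tau> = partial2 g \<tau>"
  proof -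
    have "\<forall>\<^sub>F t in nhds (\<tau> $ 2 $ 2). sym2 (\<tau> $ 1 $ 1) (\<tau> $ 1 $ 2) t \<in> siegel"
      by (rule eventually_siegel_path) (simp_all add: s)
    then have "\<forall>\<^sub>F t in nhds (\<tau> $ 2 $ 2). f (sym2 (\<tau> $ 1 $ 1) (\<tau> $ 1 $ 2) t) = g (sym2 (\<tau> $ 1 $ 1) (\<tau> $ 1 $ 2) t)"
      by eventually_elim (rule assms(1))
    then show ?thesis
      unfolding partial2_def by (intro deriv_cong_ev refl)
  qed
qed

section \<open>Calculus of homogeneous polynomials in two variables\<close>

text \<open>For \<open>j = 0\<close>, where the degree \<open>j - 1\<close> of the derivatives is truncated to 0, the guard here and the
  truncated factor in the next definition make the coefficients vanish, so that the formulas for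
  derivatives hold without a case distinction.\<close>
definition coeff_dx :: "nat \<Rightarrow> (nat \<Rightarrow> complex) \<Rightarrow> nat \<Rightarrow> complex" where
  "coeff_dx j a i = of_nat (if i < j then Suc i else 0) * a (Suc i)"

definition coeff_dy :: "nat \<Rightarrow> (nat \<Rightarrow> complex) \<Rightarrow> nat \<Rightarrow> complex" where
  "coeff_dy j a i = of_nat (j - i) * a i"

lemma hom_poly_coeff_dx:
  "hom_poly (j - 1) (coeff_dx j a) v = (\<Sum>i\<le>j. of_nat i * a i * v $ 1 ^ (i - 1) * v $ 2 ^ (j - i))"
proof (cases j)
  case 0
  then show ?thesis by (simp add: hom_poly_def coeff_dx_def)
next
  case (Suc n)
  show ?thesis
    unfolding Suc sum.atMost_Suc_shift by (simp add: hom_poly_def coeff_dx_def del: sum.atMost_Suc)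
qed

lemma hom_poly_coeff_dy:
  "hom_poly (j - 1) (coeff_dy j a) v = (\<Sum>i\<le>j. of_nat (j - i) * a i * v $ 1 ^ i * v $ 2 ^ (j - i - 1))"
proof (cases j)
  case 0
  then show ?thesis by (simp add: hom_poly_def coeff_dy_def)
next
  case (Suc n)
  show ?thesis
    unfolding Suc by (simp add: hom_poly_def coeff_dy_def)
qed

text \<open>The coefficients may move as well, as they do when a form is differentiated along a path in the
  half-space while its argument \<open>vG\<close> changes with \<open>\<tau>\<close>.\<close>
lemma hom_poly_chain:
  assumes "\<And>i. i \<le> j \<Longrightarrow> (a i has_field_derivative a' i) (at t)"
    and "(f has_field_derivative f') (at t)" "(g has_field_derivative g') (at t)"
  shows "((\<lambda>t. hom_poly j (\<lambda>i. a i t) (vector [f t, g t])) has_field_derivative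
      hom_poly j a' (vector [f t, g t]) +
      (hom_poly (j - 1) (coeff_dx j (\<lambda>i. a i t)) (vector [f t, g t]) * f' +
       hom_poly (j - 1) (coeff_dy j (\<lambda>i. a i t)) (vector [f t, g t]) * g')) (at t)"
proof -
  have "((\<lambda>t. \<Sum>i\<le>j. a i t * f t ^ i * g t ^ (j - i)) has_field_derivative
     (\<Sum>i\<le>j. a' i * f t ^ i * g t ^ (j - i) +
       (of_nat i * a i t * f t ^ (i - 1) * g t ^ (j - i) * f' +
        of_nat (j - i) * a i t * f t ^ i * g t ^ (j - i - 1) * g'))) (at t)"
    by (auto intro!: DERIV_sum derivative_eq_intros assms simp: algebra_simps)
  then show ?thesis
    unfolding hom_poly_coeff_dx hom_poly_coeff_dy
    by (simp add: hom_poly_def sum.distrib sum_distrib_right)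
qed

lemma hom_poly_zero: "hom_poly j (\<lambda>i. 0) v = 0"
  by (simp add: hom_poly_def)

lemma vector_eta_2: "vector [v $ 1, v $ 2] = (v :: 'a::zero ^ 2)"
  by (simp add: vec_eq_iff forall_2)

lemma dx_hom_poly: "dx (hom_poly j a) = hom_poly (j - 1) (coeff_dx j a)"
proof
  fix v
  show "dx (hom_poly j a) v = hom_poly (j - 1) (coeff_dx j a) v"
    unfolding dx_def
    using hom_poly_chain[where a = "\<lambda>i t. a i" and a' = "\<lambda>i. 0" and t = "v $ 1" and j = j,
        OF DERIV_const DERIV_ident DERIV_const[of "v $ 2"]]
    by (intro DERIV_imp_deriv) (simp add: vector_eta_2 hom_poly_zero)
qed

lemma dy_hom_poly: "dy (hom_poly j a) = hom_poly (j - 1) (coeff_dy j a)"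
proof
  fix v
  show "dy (hom_poly j a) v = hom_poly (j - 1) (coeff_dy j a) v"
    unfolding dy_def
    using hom_poly_chain[where a = "\<lambda>i t. a i" and a' = "\<lambda>i. 0" and t = "v $ 2" and j = j,
        OF DERIV_const DERIV_const[of "v $ 1"] DERIV_ident]
    by (intro DERIV_imp_deriv) (simp add: vector_eta_2 hom_poly_zero)
qed

lemma has_field_derivative_hom_poly_coeff:
  assumes "\<And>i. i \<le> j \<Longrightarrow> (a i has_field_derivative a' i) (at t)"
    and "(f has_field_derivative f') (at t)" "(g has_field_derivative g') (at t)"
  shows "((\<lambda>t. hom_poly j (\<lambda>i. a i t) (vector [f t, g t])) has_field_derivative
      hom_poly j a' (vector [f t, g t]) +
      (dx (hom_poly j (\<lambda>i. a i t)) (vector [f t, g t]) * f' +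
       dy (hom_poly j (\<lambda>i. a i t)) (vector [f t, g t]) * g')) (at t)"
  unfolding dx_hom_poly dy_hom_poly by (rule hom_poly_chain[OF assms])

lemma has_field_derivative_hom_poly:
  assumes "(f has_field_derivative f') (at t)" "(g has_field_derivative g') (at t)"
  shows "((\<lambda>t. hom_poly j a (vector [f t, g t])) has_field_derivative
      dx (hom_poly j a) (vector [f t, g t]) * f' + dy (hom_poly j a) (vector [f t, g t]) * g') (at t)"
  using has_field_derivative_hom_poly_coeff[where a = "\<lambda>i t. a i" and a' = "\<lambda>i. 0", OF DERIV_const assms]
  by (simp add: hom_poly_zero)

lemma dy_dx_hom_poly: "dy (dx (hom_poly j a)) = dx (dy (hom_poly j a))"
proof -
  have "coeff_dy (j - 1) (coeff_dx j a) = coeff_dx (j - 1) (coeff_dy j a)"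
    by (auto simp: coeff_dx_def coeff_dy_def fun_eq_iff)
  then show ?thesis
    by (simp add: dx_hom_poly dy_hom_poly)
qed

lemma x_dx_hom_poly:
  "v $ 1 * dx (hom_poly j a) v = (\<Sum>i\<le>j. of_nat i * a i * (v $ 1 ^ i * v $ 2 ^ (j - i)))"
  unfolding dx_hom_poly hom_poly_coeff_dx sum_distrib_left
  by (rule sum.cong) (simp_all add: power_eq_if)

lemma y_dy_hom_poly:
  "v $ 2 * dy (hom_poly j a) v = (\<Sum>i\<le>j. of_nat (j - i) * a i * (v $ 1 ^ i * v $ 2 ^ (j - i)))"
  unfolding dy_hom_poly hom_poly_coeff_dy sum_distrib_left
  by (rule sum.cong) (simp_all add: power_eq_if)

lemma euler_hom_poly:
  "v $ 1 * dx (hom_poly j a) v + v $ 2 * dy (hom_poly j a) v = of_nat j * hom_poly j a v"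
  unfolding x_dx_hom_poly y_dy_hom_poly unfolding hom_poly_def sum_distrib_left
  by (simp add: sum.distrib[symmetric] algebra_simps of_nat_diff)

text \<open>The derivatives are homogeneous of degree \<open>j - 1\<close>. The factor is the integer \<open>j - 1\<close>, not the
  truncated one: for \<open>j = 0\<close> both sides vanish.\<close>
lemma euler_dx:
  "v $ 1 * dx (dx (hom_poly j a)) v + v $ 2 * dx (dy (hom_poly j a)) v
     = (of_nat j - 1) * dx (hom_poly j a) v"
proof (cases j)
  case 0
  then show ?thesis
    unfolding dx_hom_poly dy_hom_poly by (simp add: hom_poly_def coeff_dx_def coeff_dy_def)
next
  case (Suc n)
  then show ?thesis
    using euler_hom_poly[of v n "coeff_dx (Suc n) a"]
    by (simp add: dx_hom_poly[of "Suc n" a] dy_dx_hom_poly[of "Suc n" a, symmetric])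
qed

lemma euler_dy:
  "v $ 1 * dx (dy (hom_poly j a)) v + v $ 2 * dy (dy (hom_poly j a)) v
     = (of_nat j - 1) * dy (hom_poly j a) v"
proof (cases j)
  case 0
  then show ?thesis
    unfolding dx_hom_poly dy_hom_poly by (simp add: hom_poly_def coeff_dx_def coeff_dy_def)
next
  case (Suc n)
  then show ?thesis
    using euler_hom_poly[of v n "coeff_dy (Suc n) a"]
    by (simp add: dy_hom_poly[of "Suc n" a])
qed

text \<open>The operator \<open>W(r)\<close> divided by \<open>j - 1\<close>, on polynomials of degree \<open>j\<close>: the derivative at \<open>v\<close>
  along \<open>(r\<^sub>1\<^sub>2 x + r\<^sub>2\<^sub>2 y, - r\<^sub>1\<^sub>1 x - r\<^sub>1\<^sub>2 y)\<close>.\<close>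
definition first_order_W :: "complex \<Rightarrow> complex \<Rightarrow> complex \<Rightarrow> bipoly \<Rightarrow> bipoly" where
  "first_order_W r11 r12 r22 p v = - r11 * v $ 1 * dy p v - r12 * (v $ 2 * dy p v - v $ 1 * dx p v)
     + r22 * v $ 2 * dx p v"

definition coeff_first_order_W ::
  "nat \<Rightarrow> complex \<Rightarrow> complex \<Rightarrow> complex \<Rightarrow> (nat \<Rightarrow> complex) \<Rightarrow> nat \<Rightarrow> complex" where
  "coeff_first_order_W j r11 r12 r22 a i =
     - r11 * of_nat (if i = 0 then 0 else Suc j - i) * a (i - 1)
     - r12 * (of_nat (j - i) - of_nat i) * a i
     + r22 * of_nat (if i < j then Suc i else 0) * a (Suc i)"

text \<open>The operator preserves the degree; its effect on coefficients is needed to see that the bracket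
  has holomorphic coefficients.\<close>
lemma first_order_W_hom_poly:
  "first_order_W r11 r12 r22 (hom_poly j a) = hom_poly j (coeff_first_order_W j r11 r12 r22 a)"
proof
  fix v :: "complex ^ 2"
  let ?m = "\<lambda>i. v $ 1 ^ i * v $ 2 ^ (j - i)"
  have yx: "v $ 2 * dx (hom_poly j a) v
      = (\<Sum>i\<le>j. of_nat (if i < j then Suc i else 0) * a (Suc i) * ?m i)"
  proof (cases j)
    case 0
    then show ?thesis unfolding dx_hom_poly by (simp add: hom_poly_def coeff_dx_def)
  next
    case (Suc n)
    show ?thesis
      unfolding Suc dx_hom_poly unfolding hom_poly_def sum_distrib_left
      by (auto simp: coeff_dx_def Suc_diff_le intro!: sum.cong)
  qed
  have xy: "v $ 1 * dy (hom_poly j a) v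
      = (\<Sum>i\<le>j. of_nat (if i = 0 then 0 else Suc j - i) * a (i - 1) * ?m i)"
  proof (cases j)
    case 0
    then show ?thesis unfolding dy_hom_poly by (simp add: hom_poly_def coeff_dy_def)
  next
    case (Suc n)
    show ?thesis
      unfolding Suc dy_hom_poly unfolding hom_poly_def sum_distrib_left sum.atMost_Suc_shift[of _ n]
      by (auto simp: coeff_dy_def intro!: sum.cong)
  qed
  have "first_order_W r11 r12 r22 (hom_poly j a) v = - r11 * (v $ 1 * dy (hom_poly j a) v)
      - r12 * (v $ 2 * dy (hom_poly j a) v - v $ 1 * dx (hom_poly j a) v)
      + r22 * (v $ 2 * dx (hom_poly j a) v)"
    by (simp add: first_order_W_def)
  also have "\<dots> = hom_poly j (coeff_first_order_W j r11 r12 r22 a) v"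
    unfolding x_dx_hom_poly y_dy_hom_poly yx xy unfolding hom_poly_def coeff_first_order_W_def sum_distrib_left
      sum_subtractf[symmetric] sum.distrib[symmetric]
    by (rule sum.cong) (simp_all only: algebra_simps)
  finally show "first_order_W r11 r12 r22 (hom_poly j a) v = hom_poly j (coeff_first_order_W j r11 r12 r22 a) v" .
qed

text \<open>Euler's relations for the first derivatives remove the second derivatives. The sign of the middle
  minor is the one in the cofactor expansion of the determinant.\<close>
lemma minors_hom_poly:
  "minor11 (hom_poly j a) v = (of_nat j - 1) * first_order_W 1 0 0 (hom_poly j a) v"
  "minor12 (hom_poly j a) v = - (of_nat j - 1) * first_order_W 0 1 0 (hom_poly j a) v"
  "minor22 (hom_poly j a) v = (of_nat j - 1) * first_order_W 0 0 1 (hom_poly j a) v"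
  using euler_dx[of v j a] euler_dy[of v j a]
  unfolding minor11_def minor12_def minor22_def first_order_W_def by algebra+

section \<open>The action of the symplectic group\<close>

lemma sum_UNIV_Plus:
  "sum f (UNIV :: ('a::finite + 'b::finite) set) = (\<Sum>i\<in>UNIV. f (Inl i)) + (\<Sum>i\<in>UNIV. f (Inr i))"
  unfolding UNIV_Plus_UNIV[symmetric] by (subst sum.Plus) (simp_all add: o_def)

lemma Sp4Z_entries:
  assumes "\<gamma> \<in> Sp4Z"
  shows "(\<Sum>i\<in>UNIV. \<gamma> $ Inl i $ r * \<gamma> $ Inr i $ s - \<gamma> $ Inr i $ r * \<gamma> $ Inl i $ s) = sympl_J $ r $ s"
proof -
  have "(\<Sum>i\<in>UNIV. \<gamma> $ Inl i $ r * \<gamma> $ Inr i $ s - \<gamma> $ Inr i $ r * \<gamma> $ Inl i $ s)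
      = (transpose \<gamma> ** sympl_J ** \<gamma>) $ r $ s"
    by (simp add: matrix_matrix_mult_def transpose_def sum_UNIV_Plus sum_2 sympl_J_def)
  then show ?thesis
    using assms by (simp add: Sp4Z_def)
qed

text \<open>The numerator \<open>a\<tau> + b\<close> of the action, as \<open>autfac\<close> is its denominator.\<close>
abbreviation numfac :: "int ^ (2 + 2) ^ (2 + 2) \<Rightarrow> complex ^ 2 ^ 2 \<Rightarrow> complex ^ 2 ^ 2" where
  "numfac \<gamma> \<tau> \<equiv> block_a \<gamma> ** \<tau> + block_b \<gamma>"

lemma Sp4Z_blocks:
  assumes "\<gamma> \<in> Sp4Z"
  shows "transpose (block_a \<gamma>) ** block_c \<gamma> = transpose (block_c \<gamma>) ** block_a \<gamma>"
    and "transpose (block_b \<gamma>) ** block_d \<gamma> = transpose (block_d \<gamma>) ** block_b \<gamma>"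
    and "transpose (block_a \<gamma>) ** block_d \<gamma> = transpose (block_c \<gamma>) ** block_b \<gamma> + mat 1"
    and "transpose (block_d \<gamma>) ** block_a \<gamma> = transpose (block_b \<gamma>) ** block_c \<gamma> + mat 1"
proof -
  have E: "(\<Sum>i\<in>UNIV. of_int (\<gamma> $ Inl i $ r) * of_int (\<gamma> $ Inr i $ s)
       - of_int (\<gamma> $ Inr i $ r) * of_int (\<gamma> $ Inl i $ s)) = (of_int (sympl_J $ r $ s) :: complex)" for r s
    unfolding Sp4Z_entries[OF assms, symmetric] by simp
  show "transpose (block_a \<gamma>) ** block_c \<gamma> = transpose (block_c \<gamma>) ** block_a \<gamma>"
    using E[of "Inl _" "Inl _"]
    by (simp add: vec_eq_iff matrix_matrix_mult_def transpose_def block_a_def block_c_def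
       sum_subtractf sympl_J_def)
  show "transpose (block_b \<gamma>) ** block_d \<gamma> = transpose (block_d \<gamma>) ** block_b \<gamma>"
    using E[of "Inr _" "Inr _"]
    by (simp add: vec_eq_iff matrix_matrix_mult_def transpose_def block_b_def block_d_def
       sum_subtractf sympl_J_def)
  show "transpose (block_a \<gamma>) ** block_d \<gamma> = transpose (block_c \<gamma>) ** block_b \<gamma> + mat 1"
    using E[of "Inl _" "Inr _"]
    by (simp add: vec_eq_iff matrix_matrix_mult_def transpose_def block_a_def block_b_def block_c_def
       block_d_def sum_subtractf sympl_J_def mat_def diff_eq_eq add.commute)
  show "transpose (block_d \<gamma>) ** block_a \<gamma> = transpose (block_b \<gamma>) ** block_c \<gamma> + mat 1"
    using E[of "Inr _" "Inl _"]
    by (auto simp add: vec_eq_iff matrix_matrix_mult_def transpose_def block_a_def block_b_def block_c_def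
       block_d_def sum_subtractf sympl_J_def mat_def diff_eq_eq add.commute)
qed

lemma matrix_mult_nth_2:
  "((A :: complex ^ 2 ^ 2) ** (B :: complex ^ 2 ^ 2)) $ i $ k = A $ i $ 1 * B $ 1 $ k + A $ i $ 2 * B $ 2 $ k"
  by (simp add: matrix_matrix_mult_def sum_2)

lemma transpose_nth: "transpose A $ i $ k = A $ k $ i"
  by (simp add: transpose_def)

lemma matrix_add_rdistrib: "(B + C) ** A = B ** A + C ** (A :: 'a::semiring_1 ^ 'n ^ 'm)"
  by (simp add: vec_eq_iff matrix_matrix_mult_def distrib_right sum.distrib)

lemma transpose_add: "transpose (A + B) = transpose A + transpose B"
  by (simp add: vec_eq_iff transpose_def)

text \<open>All properties of the action that are needed come from this polarised form of the symplectic
  relations, valid for arbitrary matrices: \<open>\<sigma> = N\<close> gives the symmetry of \<open>\<gamma>\<tau>\<close>, the complex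
  conjugate for \<open>\<sigma>\<close> gives the imaginary part of \<open>\<gamma>\<tau>\<close>, and a neighbouring point for \<open>N\<close> gives
  the difference of two values of the action. It is written without subtraction.\<close>
lemma sympl_identity:
  assumes "\<gamma> \<in> Sp4Z"
  shows "transpose (autfac \<gamma> \<sigma>) ** numfac \<gamma> N + transpose \<sigma> = transpose (numfac \<gamma> \<sigma>) ** autfac \<gamma> N + N"
proof -
  note B = Sp4Z_blocks[OF assms]
  note m = matrix_mul_assoc[symmetric]
  have 1: "transpose (block_c \<gamma>) ** (block_a \<gamma> ** N) = transpose (block_a \<gamma>) ** (block_c \<gamma> ** N)"
    by (simp add: matrix_mul_assoc B)
  have 2: "transpose (block_d \<gamma>) ** (block_a \<gamma> ** N) = transpose (block_b \<gamma>) ** (block_c \<gamma> ** N) + N"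
    by (simp add: matrix_mul_assoc B matrix_add_rdistrib)
  show ?thesis
    unfolding autfac_def transpose_add matrix_transpose_mul matrix_add_ldistrib matrix_add_rdistrib
      m 1 2 B(2,3) by (simp add: matrix_add_ldistrib ac_simps)
qed

text \<open>The part of the preceding identity that is linear in \<open>N\<close>.\<close>
lemma sympl_identity_c:
  assumes "\<gamma> \<in> Sp4Z"
  shows "transpose (autfac \<gamma> \<sigma>) ** block_a \<gamma> = transpose (numfac \<gamma> \<sigma>) ** block_c \<gamma> + mat 1"
proof -
  note B = Sp4Z_blocks[OF assms]
  show ?thesis
    unfolding autfac_def transpose_add matrix_transpose_mul matrix_add_rdistrib
    by (simp add: matrix_mul_assoc[symmetric] B ac_simps)
qed

lemma siegel_transpose: "\<tau> \<in> siegel \<Longrightarrow> transpose \<tau> = \<tau>"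
  by (simp add: siegel_def)

definition bil :: "complex ^ 2 \<Rightarrow> complex ^ 2 \<Rightarrow> complex" where
  "bil u v = u $ 1 * v $ 1 + u $ 2 * v $ 2"

definition cvec :: "complex ^ 2 \<Rightarrow> complex ^ 2" where
  "cvec v = (\<chi> i. cnj (v $ i))"

definition cmat :: "complex ^ 2 ^ 2 \<Rightarrow> complex ^ 2 ^ 2" where
  "cmat A = (\<chi> i k. cnj (A $ i $ k))"

lemma bil_matrix_left: "bil (A *v u) v = bil u (transpose A *v v)"
  by (simp add: bil_def matrix_vector_mult_def transpose_def sum_2 algebra_simps
      del: transpose_matrix_vector)

lemma bil_add_right: "bil u (v + w) = bil u v + bil u w"
  by (simp add: bil_def algebra_simps)

lemma cvec_mult: "cvec (A *v v) = cmat A *v cvec v"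
  by (simp add: cvec_def cmat_def matrix_vector_mult_def vec_eq_iff)

lemma cmat_autfac: "cmat (autfac \<gamma> \<tau>) = autfac \<gamma> (cmat \<tau>)"
  by (simp add: cmat_def autfac_def block_c_def block_d_def matrix_matrix_mult_def vec_eq_iff)

lemma cmat_numfac: "cmat (numfac \<gamma> \<tau>) = numfac \<gamma> (cmat \<tau>)"
  by (simp add: cmat_def block_a_def block_b_def matrix_matrix_mult_def vec_eq_iff)

text \<open>The sesquilinear consequence of \<open>sympl_identity\<close>: with \<open>x = (c\<tau> + d) w\<close> and \<open>y = (a\<tau> + b) w\<close> it says
  that \<open>x\<^sup>* y - y\<^sup>* x = 2\<i> w\<^sup>* (Im \<tau>) w\<close> for symmetric \<open>\<tau>\<close>.\<close>
lemma hermitian_identity: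
  assumes "\<gamma> \<in> Sp4Z"
  shows "bil (cvec (autfac \<gamma> \<tau> *v w)) (numfac \<gamma> \<tau> *v w) + bil (cvec w) (transpose (cmat \<tau>) *v w)
       = bil (cvec (numfac \<gamma> \<tau> *v w)) (autfac \<gamma> \<tau> *v w) + bil (cvec w) (\<tau> *v w)"
  unfolding cvec_mult cmat_autfac cmat_numfac bil_matrix_left matrix_vector_mul_assoc
    bil_add_right[symmetric] matrix_vector_mult_add_rdistrib[symmetric]
    sympl_identity[OF assms] ..

lemma hermitian_positive:
  assumes "\<tau> \<in> siegel" "w \<noteq> 0"
  shows "Im (bil (cvec w) (transpose (cmat \<tau>) *v w)) < Im (bil (cvec w) (\<tau> *v w))"
proof -
  define q where "q v = v \<bullet> ((\<chi> i k. Im (\<tau> $ i $ k)) *v v)" for v :: "real ^ 2"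
  define x y :: "real ^ 2" where "x = (\<chi> i. Re (w $ i))" and "y = (\<chi> i. Im (w $ i))"
  have s: "\<tau> $ 2 $ 1 = \<tau> $ 1 $ 2"
    using assms(1) by (simp add: siegel_iff)
  have q: "0 < q v" if "v \<noteq> 0" for v
    using assms(1) that by (simp add: siegel_def q_def)
  have q0: "0 \<le> q v" for v
    using q[of v] by (cases "v = 0") (auto simp: q_def)
  have "Im (bil (cvec w) (\<tau> *v w)) - Im (bil (cvec w) (transpose (cmat \<tau>) *v w)) = 2 * (q x + q y)"
    by (simp add: bil_def cvec_def cmat_def matrix_vector_mult_def sum_2 transpose_def s
        x_def y_def q_def inner_vec_def algebra_simps del: transpose_matrix_vector)
  moreover have "x \<noteq> 0 \<or> y \<noteq> 0"
    using assms(2) by (auto simp: x_def y_def vec_eq_iff complex_eq_iff)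
  ultimately show ?thesis
    using q[of x] q[of y] q0[of x] q0[of y] by (smt (verit))
qed

text \<open>For \<open>w\<close> in the kernel the vector \<open>x = (c\<tau> + d) w\<close> of \<open>hermitian_identity\<close> vanishes, so
  \<open>w\<^sup>* (Im \<tau>) w = 0\<close> and \<open>w = 0\<close>.\<close>
lemma det_autfac_nonzero:
  assumes "\<gamma> \<in> Sp4Z" "\<tau> \<in> siegel"
  shows "det (autfac \<gamma> \<tau>) \<noteq> 0"
proof -
  have "w = 0" if "autfac \<gamma> \<tau> *v w = 0" for w
    using hermitian_identity[OF assms(1), of \<tau> w] hermitian_positive[OF assms(2), of w] that
    by (auto simp: bil_def cvec_def)
  then show ?thesis
    using matrix_left_invertible_ker invertible_det_nz invertible_left_inverse by metis
qed

lemma matrix_inv_autfac: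
  assumes "\<gamma> \<in> Sp4Z" "\<tau> \<in> siegel"
  shows "autfac \<gamma> \<tau> ** matrix_inv (autfac \<gamma> \<tau>) = mat 1"
    and "matrix_inv (autfac \<gamma> \<tau>) ** autfac \<gamma> \<tau> = mat 1"
proof -
  have "invertible (autfac \<gamma> \<tau>)"
    using det_autfac_nonzero[OF assms] by (simp add: invertible_det_nz)
  then have "\<exists>B. autfac \<gamma> \<tau> ** B = mat 1 \<and> B ** autfac \<gamma> \<tau> = mat 1"
    by (simp add: invertible_def)
  from someI_ex[OF this]
  show "autfac \<gamma> \<tau> ** matrix_inv (autfac \<gamma> \<tau>) = mat 1"
    and "matrix_inv (autfac \<gamma> \<tau>) ** autfac \<gamma> \<tau> = mat 1"
    unfolding matrix_inv_def by auto
qed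

lemma act_mult_autfac:
  assumes "\<gamma> \<in> Sp4Z" "\<tau> \<in> siegel"
  shows "act \<gamma> \<tau> ** autfac \<gamma> \<tau> = numfac \<gamma> \<tau>"
  unfolding act_def by (simp add: matrix_mul_assoc[symmetric] matrix_inv_autfac[OF assms])

lemma transpose_act:
  assumes "\<gamma> \<in> Sp4Z" "\<tau> \<in> siegel"
  shows "transpose (act \<gamma> \<tau>) = act \<gamma> \<tau>"
proof -
  let ?G = "autfac \<gamma> \<tau>" and ?M = "numfac \<gamma> \<tau>" and ?H = "matrix_inv (autfac \<gamma> \<tau>)"
  have eq: "transpose ?G ** ?M = transpose ?M ** ?G"
    using sympl_identity[OF assms(1), of \<tau> \<tau>] siegel_transpose[OF assms(2)] by simp
  have H: "transpose ?H ** transpose ?G = mat 1"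
    by (simp add: matrix_transpose_mul[symmetric] matrix_inv_autfac[OF assms])
  have "transpose (act \<gamma> \<tau>) = transpose ?H ** (transpose ?M ** ?G) ** ?H"
    by (simp add: act_def matrix_transpose_mul matrix_mul_assoc[symmetric] matrix_inv_autfac[OF assms])
  also have "\<dots> = act \<gamma> \<tau>"
    unfolding eq[symmetric] by (simp add: matrix_mul_assoc H act_def)
  finally show ?thesis .
qed

text \<open>For real \<open>v = (c\<tau> + d) w\<close> the identity \<open>hermitian_identity\<close> expresses the quadratic form of
  \<open>Im (\<gamma>\<tau>)\<close> at \<open>v\<close> as that of \<open>Im \<tau>\<close> at \<open>w\<close>.\<close>
lemma act_in_siegel:
  assumes "\<gamma> \<in> Sp4Z" "\<tau> \<in> siegel"
  shows "act \<gamma> \<tau> \<in> siegel"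
  unfolding siegel_def mem_Collect_eq
proof (intro conjI allI impI transpose_act[OF assms])
  fix v :: "real ^ 2" assume "v \<noteq> 0"
  let ?T = "act \<gamma> \<tau>"
  define cv :: "complex ^ 2" where "cv = (\<chi> i. of_real (v $ i))"
  define w where "w = matrix_inv (autfac \<gamma> \<tau>) *v cv"
  have Gw: "autfac \<gamma> \<tau> *v w = cv"
    by (simp add: w_def matrix_vector_mul_assoc matrix_inv_autfac[OF assms])
  have Mw: "numfac \<gamma> \<tau> *v w = ?T *v cv"
    by (simp add: w_def act_def matrix_vector_mul_assoc)
  have "cv \<noteq> 0"
    using \<open>v \<noteq> 0\<close> by (auto simp: cv_def vec_eq_iff)
  then have "w \<noteq> 0"
    using Gw by auto
  from hermitian_positive[OF assms(2) this] hermitian_identity[OF assms(1), of \<tau> w]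
  have "Im (bil (cvec (?T *v cv)) cv) < Im (bil (cvec cv) (?T *v cv))"
    unfolding Gw Mw by (simp add: complex_eq_iff del: transpose_matrix_vector)
  moreover have "Im (bil (cvec cv) (?T *v cv)) = v \<bullet> ((\<chi> i k. Im (?T $ i $ k)) *v v)"
    "Im (bil (cvec (?T *v cv)) cv) = - (v \<bullet> ((\<chi> i k. Im (?T $ i $ k)) *v v))"
    by (simp_all add: bil_def cvec_def cv_def matrix_vector_mult_def sum_2 inner_vec_def algebra_simps)
  ultimately show "0 < v \<bullet> ((\<chi> i k. Im (?T $ i $ k)) *v v)"
    by linarith
qed

text \<open>The matrix \<open>H = a - (\<gamma>\<tau>) c\<close> is the inverse transpose of \<open>G = c\<tau> + d\<close>. As \<open>a\<^sup>T c\<close> and \<open>\<gamma>\<tau>\<close> are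
  symmetric, so is \<open>c\<^sup>T H\<close>, and conjugating by \<open>G\<close> gives the claim.\<close>
lemma c_autfac_symmetric:
  assumes "\<gamma> \<in> Sp4Z" "\<tau> \<in> siegel"
  shows "block_c \<gamma> ** transpose (autfac \<gamma> \<tau>) = autfac \<gamma> \<tau> ** transpose (block_c \<gamma>)"
proof -
  let ?G = "autfac \<gamma> \<tau>" and ?c = "block_c \<gamma>" and ?a = "block_a \<gamma>" and ?T = "act \<gamma> \<tau>"
  define H where "H = ?a - ?T ** ?c"
  have "transpose ?G ** ?a = transpose ?G ** ?T ** ?c + mat 1"
    using sympl_identity_c[OF assms(1), of \<tau>]
    by (simp add: act_mult_autfac[OF assms, symmetric] matrix_transpose_mul transpose_act[OF assms])
  moreover have "transpose ?G ** ?a = transpose ?G ** H + transpose ?G ** ?T ** ?c"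
    by (simp add: H_def matrix_add_ldistrib[symmetric] matrix_mul_assoc[symmetric])
  ultimately have GH: "transpose ?G ** H = mat 1"
    by simp
  from matrix_left_right_inverse1[OF GH] have HG: "H ** transpose ?G = mat 1" .
  have a: "?a = H + ?T ** ?c"
    unfolding H_def by (rule diff_add_cancel[symmetric])
  have "transpose ?c ** H + transpose ?c ** ?T ** ?c = transpose H ** ?c + transpose ?c ** ?T ** ?c"
    using Sp4Z_blocks(1)[OF assms(1)]
    by (simp only: a transpose_add matrix_transpose_mul matrix_add_ldistrib matrix_add_rdistrib
        transpose_act[OF assms] matrix_mul_assoc)
  then have "transpose ?c ** H = transpose H ** ?c"
    by (rule add_right_imp_eq)
  then have "?G ** (transpose ?c ** H) ** transpose ?G = ?G ** (transpose H ** ?c) ** transpose ?G"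
    by (rule arg_cong)
  moreover have "?G ** transpose H = mat 1"
    using arg_cong[OF HG, of transpose] by (simp add: matrix_transpose_mul)
  ultimately have "?G ** transpose ?c ** (H ** transpose ?G) = mat 1 ** (?c ** transpose ?G)"
    by (simp only: matrix_mul_assoc)
  then show ?thesis
    by (simp add: HG)
qed

section \<open>First derivatives of the transformation law\<close>

text \<open>The adjugate formula, defined for all matrices so that continuity can be checked entrywise.\<close>
definition adj_inv :: "complex ^ 2 ^ 2 \<Rightarrow> complex ^ 2 ^ 2" where
  "adj_inv A = vector [vector [A $ 2 $ 2 / det A, - A $ 1 $ 2 / det A],
                       vector [- A $ 2 $ 1 / det A, A $ 1 $ 1 / det A]]"

lemma matrix_inv_eq_adj_inv:
  assumes "det A \<noteq> 0" "A ** matrix_inv A = mat 1"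
  shows "matrix_inv A = adj_inv A"
proof -
  define d where "d = det A"
  have "A $ 2 $ 2 * A $ 1 $ 1 = d + A $ 1 $ 2 * A $ 2 $ 1" "d \<noteq> 0"
    using assms(1) by (simp_all add: d_def det_2)
  then have "adj_inv A ** A = mat 1"
    unfolding adj_inv_def d_def[symmetric]
    by (simp add: vec_eq_iff forall_2 matrix_matrix_mult_def sum_2 mat_def field_simps)
  then have "adj_inv A ** (A ** matrix_inv A) = matrix_inv A"
    by (simp add: matrix_mul_assoc)
  then show ?thesis
    using assms(2) by simp
qed

text \<open>The line through \<open>\<tau>\<close> in the symmetric direction \<open>h\<close>, given by its coordinates.\<close>
definition sym_line :: "complex ^ 2 ^ 2 \<Rightarrow> complex ^ 2 ^ 2 \<Rightarrow> complex \<Rightarrow> complex ^ 2 ^ 2" where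
  "sym_line \<tau> h t = sym2 (\<tau> $ 1 $ 1 + t * h $ 1 $ 1) (\<tau> $ 1 $ 2 + t * h $ 1 $ 2) (\<tau> $ 2 $ 2 + t * h $ 2 $ 2)"

lemma sym_line_nth:
  assumes "\<tau> \<in> siegel" "h $ 2 $ 1 = h $ 1 $ 2"
  shows "sym_line \<tau> h t $ i $ k = \<tau> $ i $ k + t * h $ i $ k"
  using assms exhaust_2[of i] exhaust_2[of k] by (auto simp: sym_line_def siegel_iff)

lemma sym_line_0: "\<tau> \<in> siegel \<Longrightarrow> sym_line \<tau> h 0 = \<tau>"
  by (simp add: sym_line_def sym2_siegel)

lemma eventually_sym_line_siegel: "\<tau> \<in> siegel \<Longrightarrow> \<forall>\<^sub>F t in nhds 0. sym_line \<tau> h t \<in> siegel"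
  unfolding sym_line_def by (rule eventually_siegel_path) (simp_all add: sym2_siegel)

text \<open>With \<open>h = G\<^sup>T e G\<close> the identity \<open>sympl_identity\<close> reads
  \<open>G\<^sup>T ((aN + b) - (\<gamma>\<tau>) (cN + d)) = t G\<^sup>T e G\<close> at the point \<open>N = \<tau> + th\<close>, so the increment of
  the action is exactly \<open>t e G (cN + d)\<^sup>-\<^sup>1\<close>. Only continuity of the last factor is then needed to find
  the derivative, and no derivative of a matrix inverse.\<close>
lemma act_sym_line:
  assumes g: "\<gamma> \<in> Sp4Z" and t: "\<tau> \<in> siegel" and N: "sym_line \<tau> h t \<in> siegel"
    and e: "e $ 2 $ 1 = e $ 1 $ 2" and G: "G = autfac \<gamma> \<tau>"
    and h: "h = transpose G ** e ** G"
  shows "act \<gamma> (sym_line \<tau> h t) $ i $ k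
      = act \<gamma> \<tau> $ i $ k + t * (e ** G ** adj_inv (autfac \<gamma> (sym_line \<tau> h t))) $ i $ k"
proof -
  let ?N = "sym_line \<tau> h t" and ?T = "act \<gamma> \<tau>"
  have hsym: "h $ 2 $ 1 = h $ 1 $ 2"
    using e by (simp add: h matrix_matrix_mult_def transpose_def sum_2 algebra_simps)
  define S :: "complex ^ 2 ^ 2 \<Rightarrow> complex ^ 2 ^ 2" where "S A = (\<chi> i k. t * A $ i $ k)" for A
  have S: "A ** S B = S (A ** B)" "S A ** B = S (A ** B)" for A B
    by (simp_all add: S_def vec_eq_iff matrix_matrix_mult_def sum_distrib_left ac_simps)
  have N_eq: "?N = \<tau> + S h"
    by (simp add: S_def vec_eq_iff sym_line_nth[OF t hsym])
  have GT: "transpose G ** ?T = transpose (numfac \<gamma> \<tau>)"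
    using arg_cong[OF act_mult_autfac[OF g t], of transpose]
    by (simp add: matrix_transpose_mul transpose_act[OF g t] G)
  have "transpose G ** numfac \<gamma> ?N + \<tau> = transpose G ** ?T ** autfac \<gamma> ?N + ?N"
    using sympl_identity[OF g, of \<tau> ?N] unfolding GT unfolding G siegel_transpose[OF t] .
  then have "transpose G ** numfac \<gamma> ?N = transpose G ** ?T ** autfac \<gamma> ?N + S h"
    by (simp add: N_eq)
  also have "\<dots> = transpose G ** (?T ** autfac \<gamma> ?N + S e ** G)"
    by (simp only: h S matrix_add_ldistrib matrix_mul_assoc)
  finally have "transpose (matrix_inv G) ** transpose G ** numfac \<gamma> ?N
      = transpose (matrix_inv G) ** transpose G ** (?T ** autfac \<gamma> ?N + S e ** G)"
    by (simp only: matrix_mul_assoc[symmetric])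
  then have M: "numfac \<gamma> ?N = ?T ** autfac \<gamma> ?N + S e ** G"
    by (simp add: matrix_transpose_mul[symmetric] matrix_inv_autfac[OF g t] G)
  have "act \<gamma> ?N = ?T ** (autfac \<gamma> ?N ** matrix_inv (autfac \<gamma> ?N))
      + S e ** G ** matrix_inv (autfac \<gamma> ?N)"
    unfolding act_def[of \<gamma> ?N] M matrix_add_rdistrib by (simp only: matrix_mul_assoc)
  also have "\<dots> = ?T + S (e ** G ** matrix_inv (autfac \<gamma> ?N))"
    by (simp only: S matrix_inv_autfac(1)[OF g N] matrix_mul_rid)
  finally have "act \<gamma> ?N = ?T + S (e ** G ** adj_inv (autfac \<gamma> ?N))"
    by (simp only: matrix_inv_eq_adj_inv[OF det_autfac_nonzero matrix_inv_autfac(1)] g N)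
  then show ?thesis
    by (simp add: S_def)
qed

lemma act_sym_line_derivative:
  assumes g: "\<gamma> \<in> Sp4Z" and t: "\<tau> \<in> siegel"
    and e: "e $ 2 $ 1 = e $ 1 $ 2" and G: "G = autfac \<gamma> \<tau>"
    and h: "h = transpose G ** e ** G"
  shows "((\<lambda>t. act \<gamma> (sym_line \<tau> h t) $ i $ k) has_field_derivative e $ i $ k) (at 0)"
proof -
  define Y where "Y t = (e ** G ** adj_inv (autfac \<gamma> (sym_line \<tau> h t))) $ i $ k" for t
  have det: "det (autfac \<gamma> (sym_line \<tau> h 0)) \<noteq> 0"
    using det_autfac_nonzero[OF g t] by (simp add: sym_line_0[OF t])
  have contG: "isCont (\<lambda>t. autfac \<gamma> (sym_line \<tau> h t) $ i $ k) 0" for i k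
    using exhaust_2[of k] unfolding autfac_def sym_line_def
    by (auto simp: matrix_matrix_mult_def sum_2)
  have contdet: "isCont (\<lambda>t. det (autfac \<gamma> (sym_line \<tau> h t))) 0"
    unfolding det_2 by (intro continuous_intros contG)
  have contA: "isCont (\<lambda>t. adj_inv (autfac \<gamma> (sym_line \<tau> h t)) $ i $ k) 0" for i k
    using exhaust_2[of i] exhaust_2[of k]
    by (elim disjE) (simp_all add: adj_inv_def, (intro continuous_intros contG contdet det)+)
  have contY: "isCont Y 0"
    unfolding Y_def matrix_mult_nth_2[of "e ** G"] by (intro continuous_intros contA)
  have Y0: "Y 0 = e $ i $ k"
    unfolding Y_def sym_line_0[OF t] G matrix_mul_assoc[symmetric]
      matrix_inv_eq_adj_inv[OF det_autfac_nonzero[OF g t] matrix_inv_autfac(1)[OF g t], symmetric]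
    by (simp add: matrix_inv_autfac[OF g t])
  have "((\<lambda>t. act \<gamma> \<tau> $ i $ k + t * Y t) has_field_derivative Y 0) (at 0)"
    unfolding CARAT_DERIV using contY by (intro exI[of _ Y]) (simp add: mult.commute)
  moreover have "\<forall>\<^sub>F t in nhds 0. act \<gamma> (sym_line \<tau> h t) $ i $ k = act \<gamma> \<tau> $ i $ k + t * Y t"
    using eventually_sym_line_siegel[OF t, of h]
    by eventually_elim (simp only: act_sym_line[OF g t _ e G h] Y_def)
  ultimately show ?thesis
    unfolding Y0 by (subst DERIV_cong_ev[OF refl _ refl])
qed

text \<open>The derivative in the symmetric direction \<open>h\<close>; the entry \<open>h\<^sub>1\<^sub>2\<close> is used once, being the increment
  of the single coordinate \<open>z\<close>.\<close>
definition deriv_along ::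
  "(complex ^ 2 ^ 2 \<Rightarrow> complex) \<Rightarrow> complex ^ 2 ^ 2 \<Rightarrow> complex ^ 2 ^ 2 \<Rightarrow> complex" where
  "deriv_along f \<tau> h = partial1 f \<tau> * h $ 1 $ 1 + partialz f \<tau> * h $ 1 $ 2 + partial2 f \<tau> * h $ 2 $ 2"

lemma vector_matrix_mult_2:
  "v v* (A :: complex ^ 2 ^ 2) =
    vector [v $ 1 * A $ 1 $ 1 + v $ 2 * A $ 2 $ 1, v $ 1 * A $ 1 $ 2 + v $ 2 * A $ 2 $ 2]"
  by (simp add: vec_eq_iff forall_2 vector_matrix_mult_def sum_2 mult.commute)

lemma vector_matrix_mult_nth_2:
  "(v v* (A :: complex ^ 2 ^ 2)) $ 1 = v $ 1 * A $ 1 $ 1 + v $ 2 * A $ 2 $ 1"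
  "(v v* A) $ 2 = v $ 1 * A $ 1 $ 2 + v $ 2 * A $ 2 $ 2"
  by (simp_all add: vector_matrix_mult_2)

text \<open>Both sides of the transformation law are differentiated along the line \<open>\<tau> + t G\<^sup>T e G\<close>. On it
  \<open>c\<tau> + d\<close> becomes \<open>(1 + t K e) G\<close>: this gives the trace term, from the determinant, and the
  velocity \<open>w\<close> of the argument \<open>v (1 + t K e) G\<close>.\<close>
lemma transformation_derivative:
  assumes g: "\<gamma> \<in> Sp4Z" and t: "\<tau> \<in> siegel" and hol: "\<And>i. siegel_holomorphic (a i)"
    and trans: "\<And>\<tau>. \<tau> \<in> siegel \<Longrightarrow> hom_poly j (\<lambda>i. a i (act \<gamma> \<tau>)) =
        rho m (autfac \<gamma> \<tau>) (hom_poly j (\<lambda>i. a i \<tau>))"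
    and e: "e $ 2 $ 1 = e $ 1 $ 2" and G: "G = autfac \<gamma> \<tau>"
    and K: "K = block_c \<gamma> ** transpose G"
    and h: "h = transpose G ** e ** G"
    and w: "w = v v* (K ** e ** G)"
  shows "hom_poly j (\<lambda>i. deriv_along (a i) (act \<gamma> \<tau>) e) v = det G ^ m *
    (hom_poly j (\<lambda>i. deriv_along (a i) \<tau> h) (v v* G)
     + of_nat m * ((K ** e) $ 1 $ 1 + (K ** e) $ 2 $ 2) * hom_poly j (\<lambda>i. a i \<tau>) (v v* G)
     + dx (hom_poly j (\<lambda>i. a i \<tau>)) (v v* G) * w $ 1
     + dy (hom_poly j (\<lambda>i. a i \<tau>)) (v v* G) * w $ 2)"
proof -
  define X where "X = K ** e"
  have hsym: "h $ 2 $ 1 = h $ 1 $ 2"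
    using e by (simp add: h matrix_matrix_mult_def transpose_def sum_2 algebra_simps)
  have Gt: "autfac \<gamma> (sym_line \<tau> h t) $ i $ k = G $ i $ k + t * (X ** G) $ i $ k" for t i k
  proof -
    have "autfac \<gamma> (sym_line \<tau> h t) $ i $ k = G $ i $ k + t * (block_c \<gamma> ** h) $ i $ k"
      using hsym t by (simp add: autfac_def G matrix_matrix_mult_def sym_line_nth sum_2 algebra_simps)
    then show ?thesis
      by (simp add: h X_def K matrix_mul_assoc)
  qed
  have detX: "det (autfac \<gamma> (sym_line \<tau> h t))
      = det G * ((1 + t * X $ 1 $ 1) * (1 + t * X $ 2 $ 2) - t * t * (X $ 1 $ 2 * X $ 2 $ 1))" for t
    unfolding det_2 Gt by (simp add: matrix_matrix_mult_def sum_2) algebra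
  have w': "w = (v v* X) v* G"
    by (simp add: w X_def vector_matrix_mul_assoc)
  have vG: "v v* autfac \<gamma> (sym_line \<tau> h t)
      = vector [(v v* G) $ 1 + t * w $ 1, (v v* G) $ 2 + t * w $ 2]" for t
    unfolding w' vector_matrix_mult_2 Gt by (simp add: matrix_matrix_mult_def sum_2 algebra_simps)
  have a_der: "((\<lambda>t. a i (sym_line \<tau> h t)) has_field_derivative deriv_along (a i) \<tau> h) (at 0)" for i
    unfolding sym_line_def deriv_along_def
    by (rule has_siegel_derivative_chain)
      (use siegel_holomorphic_derivative[OF hol t] in
        \<open>auto simp: sym2_siegel[OF t] intro!: derivative_eq_intros\<close>)
  let ?L = "\<lambda>t. hom_poly j (\<lambda>i. a i (sym2 (act \<gamma> (sym_line \<tau> h t) $ 1 $ 1)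
      (act \<gamma> (sym_line \<tau> h t) $ 1 $ 2) (act \<gamma> (sym_line \<tau> h t) $ 2 $ 2))) (vector [v $ 1, v $ 2])"
  let ?R = "\<lambda>t. (det G * ((1 + t * X $ 1 $ 1) * (1 + t * X $ 2 $ 2) - t * t * (X $ 1 $ 2 * X $ 2 $ 1))) ^ m
      * hom_poly j (\<lambda>i. a i (sym_line \<tau> h t)) (vector [(v v* G) $ 1 + t * w $ 1, (v v* G) $ 2 + t * w $ 2])"
  have L: "(?L has_field_derivative
      hom_poly j (\<lambda>i. deriv_along (a i) (act \<gamma> \<tau>) e) v) (at 0)"
  proof -
    have *: "((\<lambda>t. a i (sym2 (act \<gamma> (sym_line \<tau> h t) $ 1 $ 1)
      (act \<gamma> (sym_line \<tau> h t) $ 1 $ 2) (act \<gamma> (sym_line \<tau> h t) $ 2 $ 2))) has_field_derivative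
        deriv_along (a i) (act \<gamma> \<tau>) e) (at 0)" for i
      unfolding deriv_along_def
      by (rule has_siegel_derivative_chain)
        (use siegel_holomorphic_derivative[OF hol act_in_siegel[OF g t]] in
          \<open>simp_all add: act_sym_line_derivative[OF g t e G h] sym_line_0[OF t] sym2_siegel[OF act_in_siegel[OF g t]]\<close>)
    show ?thesis
      using has_field_derivative_hom_poly_coeff[where j = j
          and a = "\<lambda>i t. a i (sym2 (act \<gamma> (sym_line \<tau> h t) $ 1 $ 1)
            (act \<gamma> (sym_line \<tau> h t) $ 1 $ 2) (act \<gamma> (sym_line \<tau> h t) $ 2 $ 2))"
          and a' = "\<lambda>i. deriv_along (a i) (act \<gamma> \<tau>) e" and f = "\<lambda>t. v $ 1" and g = "\<lambda>t. v $ 2",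
          OF * DERIV_const DERIV_const]
      by (simp add: vector_eta_2)
  qed
  have R: "(?R has_field_derivative det G ^ m *
    (hom_poly j (\<lambda>i. deriv_along (a i) \<tau> h) (v v* G)
     + of_nat m * (X $ 1 $ 1 + X $ 2 $ 2) * hom_poly j (\<lambda>i. a i \<tau>) (v v* G)
     + dx (hom_poly j (\<lambda>i. a i \<tau>)) (v v* G) * w $ 1
     + dy (hom_poly j (\<lambda>i. a i \<tau>)) (v v* G) * w $ 2)) (at 0)"
  proof -
    have 1: "((\<lambda>t. (det G * ((1 + t * X $ 1 $ 1) * (1 + t * X $ 2 $ 2) - t * t * (X $ 1 $ 2 * X $ 2 $ 1))) ^ m)
       has_field_derivative of_nat m * (X $ 1 $ 1 + X $ 2 $ 2) * det G ^ m) (at 0)"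
    proof -
      have "((\<lambda>t. det G * ((1 + t * X $ 1 $ 1) * (1 + t * X $ 2 $ 2) - t * t * (X $ 1 $ 2 * X $ 2 $ 1)))
         has_field_derivative det G * (X $ 1 $ 1 + X $ 2 $ 2)) (at 0)"
        by (auto intro!: derivative_eq_intros simp: algebra_simps)
      from DERIV_power[OF this, of m] show ?thesis
        by (cases m) (simp_all add: algebra_simps)
    qed
    have f: "((\<lambda>t. c + t * d) has_field_derivative d) (at 0)" for c d :: complex
      by (auto intro!: derivative_eq_intros)
    show ?thesis
      using DERIV_mult[OF 1 has_field_derivative_hom_poly_coeff[where j = j
          and a = "\<lambda>i t. a i (sym_line \<tau> h t)" and a' = "\<lambda>i. deriv_along (a i) \<tau> h"
          and f = "\<lambda>t. (v v* G) $ 1 + t * w $ 1" and g = "\<lambda>t. (v v* G) $ 2 + t * w $ 2",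
          OF a_der f f]]
      by (simp add: vector_eta_2 sym_line_0[OF t] algebra_simps)
  qed
  have "\<forall>\<^sub>F t in nhds 0. ?L t = ?R t"
    using eventually_sym_line_siegel[OF t, of h]
  proof eventually_elim
    case (elim t)
    then show ?case
      by (simp add: sym2_siegel[OF act_in_siegel[OF g]] trans rho_def vG detX vector_eta_2)
  qed
  then have "(?R has_field_derivative
      hom_poly j (\<lambda>i. deriv_along (a i) (act \<gamma> \<tau>) e) v) (at 0)"
    using L by (subst (asm) DERIV_cong_ev[OF refl _ refl])
  from DERIV_unique[OF this R] show ?thesis
    unfolding X_def .
qed

section \<open>Covariance of the contraction\<close>

lemma dx_compose_matrix:
  assumes f: "\<And>v. f v = c * hom_poly j a (v v* G)"
  shows "dx f v = c * (dx (hom_poly j a) (v v* G) * G $ 1 $ 1 + dy (hom_poly j a) (v v* G) * G $ 1 $ 2)"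
    and "dy f v = c * (dx (hom_poly j a) (v v* G) * G $ 2 $ 1 + dy (hom_poly j a) (v v* G) * G $ 2 $ 2)"
proof -
  note d = derivative_eq_intros has_field_derivative_hom_poly
  show "dx f v = c * (dx (hom_poly j a) (v v* G) * G $ 1 $ 1 + dy (hom_poly j a) (v v* G) * G $ 1 $ 2)"
    unfolding dx_def[of f] f vector_matrix_mult_2
    by (intro DERIV_imp_deriv) (auto intro!: d)
  show "dy f v = c * (dx (hom_poly j a) (v v* G) * G $ 2 $ 1 + dy (hom_poly j a) (v v* G) * G $ 2 $ 2)"
    unfolding dy_def[of f] f vector_matrix_mult_2
    by (intro DERIV_imp_deriv) (auto intro!: d)
qed

text \<open>The \<open>x\<close> and \<open>y\<close> derivatives of the right-hand side that differentiation in \<open>\<tau>\<close> produces: a covariant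
  term, a multiple of \<open>p\<close>, and the derivative of \<open>p\<close> along \<open>v X\<close>.\<close>
lemma dx_transformed:
  fixes X :: "complex ^ 2 ^ 2"
  assumes f: "\<And>v. f v = c * hom_poly j l (v v* G) + s * hom_poly j a v
      + dx (hom_poly j a) v * (v v* X) $ 1 + dy (hom_poly j a) v * (v v* X) $ 2"
  shows "dx f v = c * (dx (hom_poly j l) (v v* G) * G $ 1 $ 1 + dy (hom_poly j l) (v v* G) * G $ 1 $ 2)
      + s * dx (hom_poly j a) v
      + dx (dx (hom_poly j a)) v * (v v* X) $ 1 + dx (hom_poly j a) v * X $ 1 $ 1
      + dx (dy (hom_poly j a)) v * (v v* X) $ 2 + dy (hom_poly j a) v * X $ 1 $ 2"
    and "dy f v = c * (dx (hom_poly j l) (v v* G) * G $ 2 $ 1 + dy (hom_poly j l) (v v* G) * G $ 2 $ 2)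
      + s * dy (hom_poly j a) v
      + dx (dy (hom_poly j a)) v * (v v* X) $ 1 + dx (hom_poly j a) v * X $ 2 $ 1
      + dy (dy (hom_poly j a)) v * (v v* X) $ 2 + dy (hom_poly j a) v * X $ 2 $ 2"
proof -
  have p: "((\<lambda>t. hom_poly j a (vector [t, y])) has_field_derivative dx (hom_poly j a) (vector [x, y])) (at x)"
    "((\<lambda>t. hom_poly j a (vector [x, t])) has_field_derivative dy (hom_poly j a) (vector [x, y])) (at y)"
    for j a x y
    using has_field_derivative_hom_poly[where f = "\<lambda>t. t" and g = "\<lambda>t. y" and t = x, OF DERIV_ident DERIV_const]
      has_field_derivative_hom_poly[where f = "\<lambda>t. x" and g = "\<lambda>t. t" and t = y, OF DERIV_const DERIV_ident]
    by simp_all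
  have px: "((\<lambda>t. dx (hom_poly j a) (vector [t, y])) has_field_derivative dx (dx (hom_poly j a)) (vector [x, y])) (at x)"
    "((\<lambda>t. dx (hom_poly j a) (vector [x, t])) has_field_derivative dx (dy (hom_poly j a)) (vector [x, y])) (at y)"
    for x y
    unfolding dy_dx_hom_poly[of j a, symmetric] unfolding dx_hom_poly[of j a] by (rule p)+
  have py: "((\<lambda>t. dy (hom_poly j a) (vector [t, y])) has_field_derivative dx (dy (hom_poly j a)) (vector [x, y])) (at x)"
    "((\<lambda>t. dy (hom_poly j a) (vector [x, t])) has_field_derivative dy (dy (hom_poly j a)) (vector [x, y])) (at y)"
    for x y
    unfolding dy_hom_poly[of j a] by (rule p)+
  note d = derivative_eq_intros has_field_derivative_hom_poly p px py
  let ?v = "vector [v $ 1, v $ 2]"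
  have "dx f ?v = c * (dx (hom_poly j l) (?v v* G) * G $ 1 $ 1 + dy (hom_poly j l) (?v v* G) * G $ 1 $ 2)
      + s * dx (hom_poly j a) ?v
      + dx (dx (hom_poly j a)) ?v * (?v v* X) $ 1 + dx (hom_poly j a) ?v * X $ 1 $ 1
      + dx (dy (hom_poly j a)) ?v * (?v v* X) $ 2 + dy (hom_poly j a) ?v * X $ 1 $ 2"
    unfolding dx_def[of f] f vector_matrix_mult_2
    by (intro DERIV_imp_deriv) (auto intro!: d simp: algebra_simps)
  then show "dx f v = c * (dx (hom_poly j l) (v v* G) * G $ 1 $ 1 + dy (hom_poly j l) (v v* G) * G $ 1 $ 2)
      + s * dx (hom_poly j a) v
      + dx (dx (hom_poly j a)) v * (v v* X) $ 1 + dx (hom_poly j a) v * X $ 1 $ 1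
      + dx (dy (hom_poly j a)) v * (v v* X) $ 2 + dy (hom_poly j a) v * X $ 1 $ 2"
    by (simp only: vector_eta_2)
  have "dy f ?v = c * (dx (hom_poly j l) (?v v* G) * G $ 2 $ 1 + dy (hom_poly j l) (?v v* G) * G $ 2 $ 2)
      + s * dy (hom_poly j a) ?v
      + dx (dy (hom_poly j a)) ?v * (?v v* X) $ 1 + dx (hom_poly j a) ?v * X $ 2 $ 1
      + dy (dy (hom_poly j a)) ?v * (?v v* X) $ 2 + dy (hom_poly j a) ?v * X $ 2 $ 2"
    unfolding dy_def[of f] f vector_matrix_mult_2
    by (intro DERIV_imp_deriv) (auto intro!: d simp: algebra_simps)
  then show "dy f v = c * (dx (hom_poly j l) (v v* G) * G $ 2 $ 1 + dy (hom_poly j l) (v v* G) * G $ 2 $ 2)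
      + s * dy (hom_poly j a) v
      + dx (dy (hom_poly j a)) v * (v v* X) $ 1 + dx (hom_poly j a) v * X $ 2 $ 1
      + dy (dy (hom_poly j a)) v * (v v* X) $ 2 + dy (hom_poly j a) v * X $ 2 $ 2"
    by (simp only: vector_eta_2)
qed

text \<open>The operator \<open>W(d/d\<tau>)\<close> divided by \<open>j - 1\<close>, as a function of the derivatives of a form by
  \<open>\<tau>\<^sub>1\<close>, \<open>z\<close> and \<open>\<tau>\<^sub>2\<close>; the division by 2 is the one in the off-diagonal entries of \<open>d/d\<tau>\<close>.\<close>
definition first_order_W_dtau :: "bipoly \<Rightarrow> bipoly \<Rightarrow> bipoly \<Rightarrow> bipoly" where
  "first_order_W_dtau p1 pz p2 v = first_order_W 1 0 0 p1 v + first_order_W 0 1 0 pz v / 2 + first_order_W 0 0 1 p2 v"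

text \<open>The three arguments on the left are the entries of \<open>G r G\<^sup>T\<close>. The vector field along which
  \<open>first_order_W\<close> differentiates is \<open>v r \<epsilon>\<close>, and \<open>G\<^sup>T \<epsilon> G = det G \<cdot> \<epsilon>\<close>.\<close>
lemma first_order_W_covariance:
  fixes G :: "complex ^ 2 ^ 2"
  assumes f: "\<And>v. f v = c * hom_poly j a (v v* G)"
  shows "first_order_W (G $ 1 $ 1 ^ 2 * r11 + G $ 1 $ 1 * G $ 1 $ 2 * r12 * 2 + G $ 1 $ 2 ^ 2 * r22)
     (G $ 1 $ 1 * G $ 2 $ 1 * r11 + (G $ 1 $ 1 * G $ 2 $ 2 + G $ 1 $ 2 * G $ 2 $ 1) * r12 + G $ 1 $ 2 * G $ 2 $ 2 * r22)
     (G $ 2 $ 1 ^ 2 * r11 + G $ 2 $ 1 * G $ 2 $ 2 * r12 * 2 + G $ 2 $ 2 ^ 2 * r22) f v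
    = c * det G * first_order_W r11 r12 r22 (hom_poly j a) (v v* G)"
  unfolding first_order_W_def dx_compose_matrix[OF f] vector_matrix_mult_2 det_2 vector_2 by algebra

lemma coeff_deriv_along:
  "coeff_dx j (\<lambda>i. deriv_along (a i) \<tau> h) = (\<lambda>i. coeff_dx j (\<lambda>i. partial1 (a i) \<tau>) i * h $ 1 $ 1
     + coeff_dx j (\<lambda>i. partialz (a i) \<tau>) i * h $ 1 $ 2 + coeff_dx j (\<lambda>i. partial2 (a i) \<tau>) i * h $ 2 $ 2)"
  "coeff_dy j (\<lambda>i. deriv_along (a i) \<tau> h) = (\<lambda>i. coeff_dy j (\<lambda>i. partial1 (a i) \<tau>) i * h $ 1 $ 1
     + coeff_dy j (\<lambda>i. partialz (a i) \<tau>) i * h $ 1 $ 2 + coeff_dy j (\<lambda>i. partial2 (a i) \<tau>) i * h $ 2 $ 2)"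
  by (simp_all add: fun_eq_iff coeff_dx_def coeff_dy_def deriv_along_def algebra_simps)

lemma hom_poly_combination:
  "hom_poly j (\<lambda>i. a i * r + b i * s + c i * t) v = hom_poly j a v * r + hom_poly j b v * s + hom_poly j c v * t"
  unfolding hom_poly_def sum_distrib_right sum.distrib[symmetric]
  by (rule sum.cong) (simp_all add: algebra_simps)

lemma dx_deriv_along:
  "dx (hom_poly j (\<lambda>i. deriv_along (a i) \<tau> h)) v = dx (hom_poly j (\<lambda>i. partial1 (a i) \<tau>)) v * h $ 1 $ 1
     + dx (hom_poly j (\<lambda>i. partialz (a i) \<tau>)) v * h $ 1 $ 2 + dx (hom_poly j (\<lambda>i. partial2 (a i) \<tau>)) v * h $ 2 $ 2"
  "dy (hom_poly j (\<lambda>i. deriv_along (a i) \<tau> h)) v = dy (hom_poly j (\<lambda>i. partial1 (a i) \<tau>)) v * h $ 1 $ 1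
     + dy (hom_poly j (\<lambda>i. partialz (a i) \<tau>)) v * h $ 1 $ 2 + dy (hom_poly j (\<lambda>i. partial2 (a i) \<tau>)) v * h $ 2 $ 2"
  unfolding dx_hom_poly dy_hom_poly coeff_deriv_along hom_poly_combination by (rule refl)+

text \<open>The same covariance for \<open>d/d\<tau>\<close> instead of a matrix of numbers: \<open>sym2 1 0 0\<close>, \<open>sym2 0 1 0\<close> and
  \<open>sym2 0 0 1\<close> are the directions of the three coordinates.\<close>
lemma first_order_W_dtau_covariance:
  fixes G :: "complex ^ 2 ^ 2" and c \<tau> a j
  defines "f \<equiv> \<lambda>e v. c * hom_poly j (\<lambda>i. deriv_along (a i) \<tau> (transpose G ** e ** G)) (v v* G)"
  shows "first_order_W_dtau (f (sym2 1 0 0)) (f (sym2 0 1 0)) (f (sym2 0 0 1)) v = c * det G *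
    first_order_W_dtau (hom_poly j (\<lambda>i. partial1 (a i) \<tau>)) (hom_poly j (\<lambda>i. partialz (a i) \<tau>)) (hom_poly j (\<lambda>i. partial2 (a i) \<tau>)) (v v* G)"
proof -
  have d: "dx (f e) v = c * (dx (hom_poly j (\<lambda>i. deriv_along (a i) \<tau> (transpose G ** e ** G))) (v v* G) * G $ 1 $ 1
      + dy (hom_poly j (\<lambda>i. deriv_along (a i) \<tau> (transpose G ** e ** G))) (v v* G) * G $ 1 $ 2)"
    "dy (f e) v = c * (dx (hom_poly j (\<lambda>i. deriv_along (a i) \<tau> (transpose G ** e ** G))) (v v* G) * G $ 2 $ 1
      + dy (hom_poly j (\<lambda>i. deriv_along (a i) \<tau> (transpose G ** e ** G))) (v v* G) * G $ 2 $ 2)" for e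
    by (rule dx_compose_matrix; simp add: f_def)+
  show ?thesis
    unfolding first_order_W_dtau_def first_order_W_def d dx_deriv_along matrix_mult_nth_2 transpose_nth sym2_nth
      vector_matrix_mult_nth_2 det_2
    by (simp add: field_simps) 
qed

text \<open>The contraction of the connection terms. The trace term gives the factor \<open>m\<close>. In the derivative
  along \<open>v K e\<close> the second derivatives of \<open>p\<close> combine by Euler's relation into \<open>(j - 1)/2\<close> times
  \<open>first_order_W K p\<close>, and differentiating the factor \<open>v\<close> costs another half of it, which leaves
  \<open>j/2 - 1\<close>.\<close>
lemma first_order_W_dtau_connection:
  fixes K G :: "complex ^ 2 ^ 2" and c j l
  assumes K: "K $ 2 $ 1 = K $ 1 $ 2"
    and f: "\<And>e v. e $ 2 $ 1 = e $ 1 $ 2 \<Longrightarrow> f e v = c * hom_poly j (l e) (v v* G)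
      + m * ((K ** e) $ 1 $ 1 + (K ** e) $ 2 $ 2) * hom_poly j a v
      + dx (hom_poly j a) v * (v v* (K ** e)) $ 1 + dy (hom_poly j a) v * (v v* (K ** e)) $ 2"
  defines "g \<equiv> \<lambda>e v. c * hom_poly j (l e) (v v* G)"
  shows "first_order_W_dtau (f (sym2 1 0 0)) (f (sym2 0 1 0)) (f (sym2 0 0 1)) v
    = first_order_W_dtau (g (sym2 1 0 0)) (g (sym2 0 1 0)) (g (sym2 0 0 1)) v
      + (m + of_nat j / 2 - 1) * first_order_W (K $ 1 $ 1) (K $ 1 $ 2) (K $ 2 $ 2) (hom_poly j a) v"
proof -
  have g: "dx (g e) v = c * (dx (hom_poly j (l e)) (v v* G) * G $ 1 $ 1 + dy (hom_poly j (l e)) (v v* G) * G $ 1 $ 2)"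
    "dy (g e) v = c * (dx (hom_poly j (l e)) (v v* G) * G $ 2 $ 1 + dy (hom_poly j (l e)) (v v* G) * G $ 2 $ 2)" for e
    by (rule dx_compose_matrix; simp add: g_def)+
  let ?p = "hom_poly j a"
  have d: "dx (f e) v = dx (g e) v + m * ((K ** e) $ 1 $ 1 + (K ** e) $ 2 $ 2) * dx ?p v
      + dx (dx ?p) v * (v v* (K ** e)) $ 1 + dx ?p v * (K ** e) $ 1 $ 1
      + dx (dy ?p) v * (v v* (K ** e)) $ 2 + dy ?p v * (K ** e) $ 1 $ 2"
    "dy (f e) v = dy (g e) v + m * ((K ** e) $ 1 $ 1 + (K ** e) $ 2 $ 2) * dy ?p v
      + dx (dy ?p) v * (v v* (K ** e)) $ 1 + dx ?p v * (K ** e) $ 2 $ 1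
      + dy (dy ?p) v * (v v* (K ** e)) $ 2 + dy ?p v * (K ** e) $ 2 $ 2"
    if "e $ 2 $ 1 = e $ 1 $ 2" for e
    unfolding g by (rule dx_transformed[OF f[OF that]])+
  show ?thesis
    using euler_dx[of v j a] euler_dy[of v j a]
    unfolding first_order_W_dtau_def first_order_W_def
    by (simp add: d matrix_mult_nth_2 vector_matrix_mult_nth_2 K field_simps) algebra
qed

section \<open>The bracket\<close>

text \<open>Coefficients beyond the degree are chosen to be 0, so that all of them are holomorphic.\<close>
lemma modular_form_coefficients:
  assumes "F \<in> modular_forms j k"
  obtains a where "\<And>i. siegel_holomorphic (a i)"
    "\<And>\<tau>. \<tau> \<in> siegel \<Longrightarrow> F \<tau> = hom_poly j (\<lambda>i. a i \<tau>)"
proof -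
  obtain a where a: "\<And>i. i \<le> j \<Longrightarrow> siegel_holomorphic (a i)"
    "\<And>\<tau>. \<tau> \<in> siegel \<Longrightarrow> F \<tau> = hom_poly j (\<lambda>i. a i \<tau>)"
  proof -
    have "holomorphic_Hom j F"
      using assms by (simp add: modular_forms_def)
    then show ?thesis
      unfolding holomorphic_Hom_def using that by blast
  qed
  show ?thesis
  proof (rule that[of "\<lambda>i. if i \<le> j then a i else (\<lambda>\<tau>. 0)"])
    show "siegel_holomorphic (if i \<le> j then a i else (\<lambda>\<tau>. 0))" for i
      using a(1) siegel_holomorphic_const by simp
    show "F \<tau> = hom_poly j (\<lambda>i. (if i \<le> j then a i else (\<lambda>\<tau>. 0)) \<tau>)" if "\<tau> \<in> siegel" for \<tau>
      unfolding a(2)[OF that] by (auto simp: hom_poly_def intro!: sum.cong)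
  qed
qed

lemma has_siegel_derivative_cmult:
  assumes "has_siegel_derivative f \<tau> A B C" "\<tau> \<in> siegel"
  shows "has_siegel_derivative (\<lambda>\<tau>. c * f \<tau>) \<tau> (c * A) (c * B) (c * C)"
  using has_siegel_derivative_mult[OF has_siegel_derivative_const assms, of c] by simp

lemma has_siegel_derivative_hom_poly:
  assumes "\<And>i. i \<le> j \<Longrightarrow> has_siegel_derivative (a i) \<tau> (A i) (B i) (C i)" "\<tau> \<in> siegel"
  shows "has_siegel_derivative (\<lambda>\<tau>. hom_poly j (\<lambda>i. a i \<tau>) v) \<tau>
    (hom_poly j A v) (hom_poly j B v) (hom_poly j C v)"
proof -
  have eq: "hom_poly j a v = (\<Sum>i\<le>j. (v $ 1 ^ i * v $ 2 ^ (j - i)) * a i)" for a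
    by (simp add: hom_poly_def ac_simps)
  show ?thesis
    unfolding eq by (intro has_siegel_derivative_sum has_siegel_derivative_cmult assms) auto
qed

lemma has_siegel_derivative_coeff_first_order_W:
  assumes "\<And>i. has_siegel_derivative (a i) \<tau> (A i) (B i) (C i)" "\<tau> \<in> siegel"
  shows "has_siegel_derivative (\<lambda>\<tau>. coeff_first_order_W j r11 r12 r22 (\<lambda>i. a i \<tau>) i) \<tau>
    (coeff_first_order_W j r11 r12 r22 A i) (coeff_first_order_W j r11 r12 r22 B i) (coeff_first_order_W j r11 r12 r22 C i)"
proof -
  obtain c0 c1 c2 where c: "coeff_first_order_W j r11 r12 r22 a i = c0 * a (i - 1) + c1 * a i + c2 * a (Suc i)" for a
    by (rule that[of "- r11 * of_nat (if i = 0 then 0 else Suc j - i)"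
          "- r12 * (of_nat (j - i) - of_nat i)" "r22 * of_nat (if i < j then Suc i else 0)"])
      (simp add: coeff_first_order_W_def)
  show ?thesis
    unfolding c by (intro has_siegel_derivative_add has_siegel_derivative_cmult assms)
qed

text \<open>Differentiation in \<open>\<tau>\<close> commutes with the operators in \<open>x\<close> and \<open>y\<close>.\<close>
lemma partial_first_order_W:
  assumes "\<And>i. siegel_holomorphic (a i)" "\<tau> \<in> siegel"
    and "\<And>\<sigma>. \<sigma> \<in> siegel \<Longrightarrow> f \<sigma> = c * first_order_W r11 r12 r22 (hom_poly j (\<lambda>i. a i \<sigma>)) v"
  shows "partial1 f \<tau> = c * first_order_W r11 r12 r22 (hom_poly j (\<lambda>i. partial1 (a i) \<tau>)) v"
    and "partialz f \<tau> = c * first_order_W r11 r12 r22 (hom_poly j (\<lambda>i. partialz (a i) \<tau>)) v"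
    and "partial2 f \<tau> = c * first_order_W r11 r12 r22 (hom_poly j (\<lambda>i. partial2 (a i) \<tau>)) v"
proof -
  define g where "g \<sigma> = c * hom_poly j (coeff_first_order_W j r11 r12 r22 (\<lambda>i. a i \<sigma>)) v" for \<sigma>
  have fg: "f \<sigma> = g \<sigma>" if "\<sigma> \<in> siegel" for \<sigma>
    unfolding assms(3)[OF that] g_def first_order_W_hom_poly ..
  have g: "has_siegel_derivative g \<tau> (c * first_order_W r11 r12 r22 (hom_poly j (\<lambda>i. partial1 (a i) \<tau>)) v)
      (c * first_order_W r11 r12 r22 (hom_poly j (\<lambda>i. partialz (a i) \<tau>)) v)
      (c * first_order_W r11 r12 r22 (hom_poly j (\<lambda>i. partial2 (a i) \<tau>)) v)"
    unfolding g_def first_order_W_hom_poly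
    by (intro has_siegel_derivative_cmult has_siegel_derivative_hom_poly
        has_siegel_derivative_coeff_first_order_W siegel_holomorphic_derivative assms)
  show "partial1 f \<tau> = c * first_order_W r11 r12 r22 (hom_poly j (\<lambda>i. partial1 (a i) \<tau>)) v"
    and "partialz f \<tau> = c * first_order_W r11 r12 r22 (hom_poly j (\<lambda>i. partialz (a i) \<tau>)) v"
    and "partial2 f \<tau> = c * first_order_W r11 r12 r22 (hom_poly j (\<lambda>i. partial2 (a i) \<tau>)) v"
    using partial_cong[of f g, OF fg assms(2)] has_siegel_derivative_unique[OF g] by simp_all
qed

text \<open>The factor \<open>j - 1\<close> of \<open>minors_hom_poly\<close> occurs in both terms and cancels the denominator of the
  bracket.\<close>
lemma bracket_eq:
  assumes j: "j \<noteq> 1" and t: "\<tau> \<in> siegel" and a: "\<And>i. siegel_holomorphic (a i)"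
    and F: "\<And>\<tau>. \<tau> \<in> siegel \<Longrightarrow> F \<tau> = hom_poly j (\<lambda>i. a i \<tau>)"
    and \<phi>: "\<And>\<tau> v. \<tau> \<in> siegel \<Longrightarrow> \<phi> \<tau> v = b \<tau>"
  shows "bracket j k l F \<phi> \<tau> v = 1 / (2 * of_real pi * \<i>) *
    ((of_nat k + of_nat j / 2 - 1) *
       first_order_W (partial1 b \<tau>) (partialz b \<tau> / 2) (partial2 b \<tau>) (hom_poly j (\<lambda>i. a i \<tau>)) v
     - of_nat l * b \<tau> * first_order_W_dtau (hom_poly j (\<lambda>i. partial1 (a i) \<tau>)) (hom_poly j (\<lambda>i. partialz (a i) \<tau>))
         (hom_poly j (\<lambda>i. partial2 (a i) \<tau>)) v)"
proof -
  have j1: "of_nat j - 1 \<noteq> (0 :: complex)"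
    using j by simp
  have d: "d_tau1 G \<sigma> v = partial1 (\<lambda>\<sigma>. G \<sigma> v) \<sigma>" "d_z G \<sigma> v = partialz (\<lambda>\<sigma>. G \<sigma> v) \<sigma>"
    "d_tau2 G \<sigma> v = partial2 (\<lambda>\<sigma>. G \<sigma> v) \<sigma>" for G \<sigma> v
    by (simp_all add: d_tau1_def d_z_def d_tau2_def partial1_def partialz_def partial2_def)
  have d\<phi>: "d_tau1 \<phi> \<tau> v = partial1 b \<tau>" "d_z \<phi> \<tau> v = partialz b \<tau>" "d_tau2 \<phi> \<tau> v = partial2 b \<tau>"
    unfolding d using partial_cong[of "\<lambda>\<sigma>. \<phi> \<sigma> v" b, OF \<phi> t] by simp_all
  have dF: "d_tau1 (\<lambda>\<sigma>. minor11 (F \<sigma>)) \<tau> v = (of_nat j - 1) * first_order_W 1 0 0 (hom_poly j (\<lambda>i. partial1 (a i) \<tau>)) v"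
    "d_z (\<lambda>\<sigma>. minor12 (F \<sigma>)) \<tau> v = - (of_nat j - 1) * first_order_W 0 1 0 (hom_poly j (\<lambda>i. partialz (a i) \<tau>)) v"
    "d_tau2 (\<lambda>\<sigma>. minor22 (F \<sigma>)) \<tau> v = (of_nat j - 1) * first_order_W 0 0 1 (hom_poly j (\<lambda>i. partial2 (a i) \<tau>)) v"
    unfolding d by (rule partial_first_order_W[where a = a, OF a t]; simp only: F minors_hom_poly)+
  have 1: "W (mult_d_dtau \<phi>) F \<tau> v = (of_nat j - 1) *
      first_order_W (partial1 b \<tau>) (partialz b \<tau> / 2) (partial2 b \<tau>) (hom_poly j (\<lambda>i. a i \<tau>)) v"
    by (simp add: W_def mult_d_dtau_def d_dtau_def d\<phi> F[OF t] minors_hom_poly first_order_W_def field_simps)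
  have 2: "W d_dtau F \<tau> v = (of_nat j - 1) * first_order_W_dtau (hom_poly j (\<lambda>i. partial1 (a i) \<tau>))
      (hom_poly j (\<lambda>i. partialz (a i) \<tau>)) (hom_poly j (\<lambda>i. partial2 (a i) \<tau>)) v"
    by (simp add: W_def d_dtau_def dF first_order_W_dtau_def algebra_simps diff_divide_distrib)
  show ?thesis
    unfolding bracket_def 1 2 \<phi>[OF t] using j1 by (simp add: field_simps)
qed

text \<open>The law of \<open>transformation_derivative\<close> with the connection terms expressed by the polynomial at
  \<open>\<gamma>\<tau>\<close>, whose derivative at \<open>v\<close> along \<open>v K e\<close> is \<open>det G\<^sup>m\<close> times that of the polynomial at \<open>\<tau>\<close> along
  \<open>v K e G\<close>.\<close>
lemma first_order_transformation:
  assumes g: "\<gamma> \<in> Sp4Z" and t: "\<tau> \<in> siegel" and a: "\<And>i. siegel_holomorphic (a i)"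
    and trans: "\<And>\<tau>. \<tau> \<in> siegel \<Longrightarrow> hom_poly j (\<lambda>i. a i (act \<gamma> \<tau>)) =
        rho m (autfac \<gamma> \<tau>) (hom_poly j (\<lambda>i. a i \<tau>))"
    and e: "e $ 2 $ 1 = e $ 1 $ 2" and G: "G = autfac \<gamma> \<tau>"
    and K: "K = block_c \<gamma> ** transpose G"
  shows "hom_poly j (\<lambda>i. deriv_along (a i) (act \<gamma> \<tau>) e) v =
     det G ^ m * hom_poly j (\<lambda>i. deriv_along (a i) \<tau> (transpose G ** e ** G)) (v v* G)
     + of_nat m * ((K ** e) $ 1 $ 1 + (K ** e) $ 2 $ 2) * hom_poly j (\<lambda>i. a i (act \<gamma> \<tau>)) v
     + dx (hom_poly j (\<lambda>i. a i (act \<gamma> \<tau>))) v * (v v* (K ** e)) $ 1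
     + dy (hom_poly j (\<lambda>i. a i (act \<gamma> \<tau>))) v * (v v* (K ** e)) $ 2"
proof -
  have p: "hom_poly j (\<lambda>i. a i (act \<gamma> \<tau>)) v = det G ^ m * hom_poly j (\<lambda>i. a i \<tau>) (v v* G)" for v
    unfolding trans[OF t] by (simp add: rho_def G)
  have w: "(v v* (K ** e ** G)) $ 1 = (v v* (K ** e)) $ 1 * G $ 1 $ 1 + (v v* (K ** e)) $ 2 * G $ 2 $ 1"
    "(v v* (K ** e ** G)) $ 2 = (v v* (K ** e)) $ 1 * G $ 1 $ 2 + (v v* (K ** e)) $ 2 * G $ 2 $ 2"
    unfolding vector_matrix_mul_assoc[symmetric] by (rule vector_matrix_mult_nth_2)+
  note transformation_derivative[where a = a and v = v, OF g t a trans e G K refl refl]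
  then show ?thesis
    unfolding dx_compose_matrix[OF p] p w by (simp add: algebra_simps)
qed

lemma bracket_holomorphic:
  assumes "j \<noteq> 1" and a: "\<And>i. siegel_holomorphic (a i)"
    and "\<And>\<tau>. \<tau> \<in> siegel \<Longrightarrow> F \<tau> = hom_poly j (\<lambda>i. a i \<tau>)"
    and b: "siegel_holomorphic b" and "\<And>\<tau> v. \<tau> \<in> siegel \<Longrightarrow> \<phi> \<tau> v = b \<tau>"
  shows "holomorphic_Hom j (bracket j k l F \<phi>)"
proof -
  define c where "c i \<tau> = 1 / (2 * of_real pi * \<i>) *
    ((of_nat k + of_nat j / 2 - 1) * coeff_first_order_W j (partial1 b \<tau>) (partialz b \<tau> * (1 / 2)) (partial2 b \<tau>) (\<lambda>i. a i \<tau>) i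
     - of_nat l * b \<tau> * (coeff_first_order_W j 1 0 0 (\<lambda>i. partial1 (a i) \<tau>) i
        + coeff_first_order_W j 0 1 0 (\<lambda>i. partialz (a i) \<tau>) i * (1 / 2) + coeff_first_order_W j 0 0 1 (\<lambda>i. partial2 (a i) \<tau>) i))"
    for i \<tau>
  have "siegel_holomorphic (c i)" for i
    unfolding c_def coeff_first_order_W_def
    by (intro siegel_holomorphic_const siegel_holomorphic_add siegel_holomorphic_diff
        siegel_holomorphic_mult siegel_holomorphic_uminus siegel_holomorphic_partial a b)
  moreover have "bracket j k l F \<phi> \<tau> = hom_poly j (\<lambda>i. c i \<tau>)" if t: "\<tau> \<in> siegel" for \<tau>
  proof
    fix v
    have "hom_poly j (\<lambda>i. c i \<tau>) v = 1 / (2 * of_real pi * \<i>) *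
      ((of_nat k + of_nat j / 2 - 1) * hom_poly j (coeff_first_order_W j (partial1 b \<tau>) (partialz b \<tau> * (1 / 2)) (partial2 b \<tau>) (\<lambda>i. a i \<tau>)) v
       - of_nat l * b \<tau> * (hom_poly j (coeff_first_order_W j 1 0 0 (\<lambda>i. partial1 (a i) \<tau>)) v
        + hom_poly j (coeff_first_order_W j 0 1 0 (\<lambda>i. partialz (a i) \<tau>)) v * (1 / 2)
        + hom_poly j (coeff_first_order_W j 0 0 1 (\<lambda>i. partial2 (a i) \<tau>)) v))"
      unfolding hom_poly_def sum_distrib_left sum_distrib_right sum.distrib[symmetric] sum_subtractf[symmetric]
      by (rule sum.cong) (simp_all add: c_def algebra_simps)
    then show "bracket j k l F \<phi> \<tau> v = hom_poly j (\<lambda>i. c i \<tau>) v"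
      by (subst bracket_eq[where a = a and b = b, OF assms(1) t a assms(3,5)])
        (simp_all add: first_order_W_dtau_def first_order_W_hom_poly)
  qed
  ultimately show ?thesis
    unfolding holomorphic_Hom_def by blast
qed

text \<open>In \<open>W_b\<close> and \<open>W_a\<close> the last summands are the deviations from covariance. They carry the factors
  \<open>l\<close> and \<open>k + j/2 - 1\<close>, which the bracket multiplies crosswise and subtracts.\<close>
lemma bracket_transformation:
  assumes j: "j \<noteq> 1" and a: "\<And>i. siegel_holomorphic (a i)"
    and F: "\<And>\<tau>. \<tau> \<in> siegel \<Longrightarrow> F \<tau> = hom_poly j (\<lambda>i. a i \<tau>)"
    and b: "siegel_holomorphic b" and \<phi>: "\<And>\<tau> v. \<tau> \<in> siegel \<Longrightarrow> \<phi> \<tau> v = b \<tau>"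
    and g: "\<gamma> \<in> Sp4Z"
    and Ftrans: "\<And>\<tau>. \<tau> \<in> siegel \<Longrightarrow> F (act \<gamma> \<tau>) = rho k (autfac \<gamma> \<tau>) (F \<tau>)"
    and \<phi>trans: "\<And>\<tau>. \<tau> \<in> siegel \<Longrightarrow> \<phi> (act \<gamma> \<tau>) = rho l (autfac \<gamma> \<tau>) (\<phi> \<tau>)"
    and t: "\<tau> \<in> siegel"
  shows "bracket j k l F \<phi> (act \<gamma> \<tau>) v
    = rho (k + l + 1) (autfac \<gamma> \<tau>) (bracket j k l F \<phi> \<tau>) v"
proof -
  define G where "G = autfac \<gamma> \<tau>"
  define K where "K = block_c \<gamma> ** transpose G"
  let ?T = "act \<gamma> \<tau>"
  have T: "?T \<in> siegel"
    by (rule act_in_siegel[OF g t])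
  have Ksym: "K $ 2 $ 1 = K $ 1 $ 2"
  proof -
    have "transpose K = K"
      using c_autfac_symmetric[OF g t] by (simp add: K_def G_def matrix_transpose_mul)
    then have "transpose K $ 1 $ 2 = K $ 1 $ 2" by simp
    then show ?thesis by (simp add: transpose_def)
  qed
  let ?p = "hom_poly j (\<lambda>i. a i \<tau>)" and ?p' = "hom_poly j (\<lambda>i. a i ?T)"
  have atrans: "hom_poly j (\<lambda>i. a i (act \<gamma> \<tau>)) = rho k (autfac \<gamma> \<tau>) (hom_poly j (\<lambda>i. a i \<tau>))"
    if "\<tau> \<in> siegel" for \<tau>
    using Ftrans[OF that] F[OF that] F[OF act_in_siegel[OF g that]] by simp
  have p': "?p' v = det G ^ k * ?p (v v* G)" for v
    unfolding atrans[OF t] by (simp add: rho_def G_def)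
  have btrans: "b (act \<gamma> \<tau>) = det (autfac \<gamma> \<tau>) ^ l * b \<tau>" if "\<tau> \<in> siegel" for \<tau>
    using fun_cong[OF \<phi>trans[OF that], of 0] \<phi>[OF that] \<phi>[OF act_in_siegel[OF g that]]
    by (simp add: rho_def)
  \<comment> \<open>A classical form is a vector-valued form of degree 0, whose polynomials have no derivatives.\<close>
  have b': "deriv_along b ?T e = det G ^ l *
      (deriv_along b \<tau> (transpose G ** e ** G) + of_nat l * ((K ** e) $ 1 $ 1 + (K ** e) $ 2 $ 2) * b \<tau>)"
    if e: "e $ 2 $ 1 = e $ 1 $ 2" for e
  proof -
    have 0: "hom_poly 0 c = (\<lambda>v. c 0)" for c
      by (simp add: hom_poly_def fun_eq_iff)
    have d0: "dx (\<lambda>v. c) = (\<lambda>v. 0)" "dy (\<lambda>v. c) = (\<lambda>v. 0)" for c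
      by (simp_all add: dx_def dy_def fun_eq_iff)
    show ?thesis
      using first_order_transformation[where a = "\<lambda>i. b" and j = 0 and m = l, OF g t b _ e G_def K_def]
        btrans[OF t] by (simp add: 0 d0 rho_def btrans G_def algebra_simps)
  qed
  have W_b: "first_order_W (partial1 b ?T) (partialz b ?T / 2) (partial2 b ?T) ?p' v
    = det G ^ (k + l + 1) * first_order_W (partial1 b \<tau>) (partialz b \<tau> / 2) (partial2 b \<tau>) ?p (v v* G)
      + of_nat l * b ?T * first_order_W (K $ 1 $ 1) (K $ 1 $ 2) (K $ 2 $ 2) ?p' v"
  proof -
    note d = b'[of "sym2 1 0 0"] b'[of "sym2 0 1 0"] b'[of "sym2 0 0 1"]
    have "first_order_W (partial1 b ?T) (partialz b ?T / 2) (partial2 b ?T) ?p' v = det G ^ l *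
      (first_order_W (G $ 1 $ 1 ^ 2 * partial1 b \<tau> + G $ 1 $ 1 * G $ 1 $ 2 * (partialz b \<tau> / 2) * 2 + G $ 1 $ 2 ^ 2 * partial2 b \<tau>)
         (G $ 1 $ 1 * G $ 2 $ 1 * partial1 b \<tau> + (G $ 1 $ 1 * G $ 2 $ 2 + G $ 1 $ 2 * G $ 2 $ 1) * (partialz b \<tau> / 2)
           + G $ 1 $ 2 * G $ 2 $ 2 * partial2 b \<tau>)
         (G $ 2 $ 1 ^ 2 * partial1 b \<tau> + G $ 2 $ 1 * G $ 2 $ 2 * (partialz b \<tau> / 2) * 2 + G $ 2 $ 2 ^ 2 * partial2 b \<tau>) ?p' v
       + of_nat l * b \<tau> * first_order_W (K $ 1 $ 1) (K $ 1 $ 2) (K $ 2 $ 2) ?p' v)"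
      using d unfolding deriv_along_def matrix_mult_nth_2 transpose_nth sym2_nth Ksym first_order_W_def
      by (simp add: field_simps power2_eq_square)
    also have "\<dots> = det G ^ l * (det G ^ k * det G * first_order_W (partial1 b \<tau>) (partialz b \<tau> / 2) (partial2 b \<tau>) ?p (v v* G)
       + of_nat l * b \<tau> * first_order_W (K $ 1 $ 1) (K $ 1 $ 2) (K $ 2 $ 2) ?p' v)"
      unfolding first_order_W_covariance[OF p'] ..
    finally show ?thesis
      by (simp add: btrans[OF t] G_def power_add algebra_simps)
  qed
  let ?P = "\<lambda>\<sigma>. first_order_W_dtau (hom_poly j (\<lambda>i. partial1 (a i) \<sigma>)) (hom_poly j (\<lambda>i. partialz (a i) \<sigma>)) (hom_poly j (\<lambda>i. partial2 (a i) \<sigma>))"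
  have W_a: "?P ?T v = det G ^ (k + 1) * ?P \<tau> (v v* G)
      + (of_nat k + of_nat j / 2 - 1) * first_order_W (K $ 1 $ 1) (K $ 1 $ 2) (K $ 2 $ 2) ?p' v"
  proof -
    let ?f = "\<lambda>e. hom_poly j (\<lambda>i. deriv_along (a i) ?T e)"
    have "?P ?T v = first_order_W_dtau (?f (sym2 1 0 0)) (?f (sym2 0 1 0)) (?f (sym2 0 0 1)) v"
      by (simp add: deriv_along_def)
    also have "\<dots> = first_order_W_dtau
        (\<lambda>v. det G ^ k * hom_poly j (\<lambda>i. deriv_along (a i) \<tau> (transpose G ** sym2 1 0 0 ** G)) (v v* G))
        (\<lambda>v. det G ^ k * hom_poly j (\<lambda>i. deriv_along (a i) \<tau> (transpose G ** sym2 0 1 0 ** G)) (v v* G))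
        (\<lambda>v. det G ^ k * hom_poly j (\<lambda>i. deriv_along (a i) \<tau> (transpose G ** sym2 0 0 1 ** G)) (v v* G)) v
      + (of_nat k + of_nat j / 2 - 1) * first_order_W (K $ 1 $ 1) (K $ 1 $ 2) (K $ 2 $ 2) ?p' v"
      by (rule first_order_W_dtau_connection[OF Ksym first_order_transformation[where a = a, OF g t a atrans _ G_def K_def]])
    also have "\<dots> = det G ^ k * det G * ?P \<tau> (v v* G)
      + (of_nat k + of_nat j / 2 - 1) * first_order_W (K $ 1 $ 1) (K $ 1 $ 2) (K $ 2 $ 2) ?p' v"
      unfolding first_order_W_dtau_covariance ..
    finally show ?thesis
      by simp
  qed
  have eq: "bracket j k l F \<phi> \<sigma> v = 1 / (2 * of_real pi * \<i>) *
      ((of_nat k + of_nat j / 2 - 1) *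
         first_order_W (partial1 b \<sigma>) (partialz b \<sigma> / 2) (partial2 b \<sigma>) (hom_poly j (\<lambda>i. a i \<sigma>)) v
       - of_nat l * b \<sigma> * ?P \<sigma> v)" if "\<sigma> \<in> siegel" for \<sigma> v
    by (rule bracket_eq[OF j that a F \<phi>])
  show ?thesis
    unfolding rho_def G_def[symmetric] eq[OF T] eq[OF t] W_b W_a
    by (simp add: btrans[OF t] G_def[symmetric] power_add field_simps)
qed

theorem proposition2p5:
  fixes j k l :: nat and F \<phi> :: form
  assumes "j \<noteq> 1"
    and "F \<in> modular_forms j k"
    and "\<phi> \<in> classical_forms l"
  shows "bracket j k l F \<phi> \<in> modular_forms j (k + l + 1)"
proof -
  obtain a where a: "\<And>i. siegel_holomorphic (a i)"
    "\<And>\<tau>. \<tau> \<in> siegel \<Longrightarrow> F \<tau> = hom_poly j (\<lambda>i. a i \<tau>)"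
    using modular_form_coefficients[OF assms(2)] by blast
  obtain b where b: "\<And>i. siegel_holomorphic (b i)"
    "\<And>\<tau>. \<tau> \<in> siegel \<Longrightarrow> \<phi> \<tau> = hom_poly 0 (\<lambda>i. b i \<tau>)"
    using modular_form_coefficients[OF assms(3)] by blast
  have \<phi>: "\<phi> \<tau> v = b 0 \<tau>" if "\<tau> \<in> siegel" for \<tau> v
    using b(2)[OF that] by (simp add: hom_poly_def)
  have hol: "holomorphic_Hom j (bracket j k l F \<phi>)"
    by (rule bracket_holomorphic[where a = a, OF assms(1) a b(1) \<phi>])
  moreover from hol have "bracket j k l F \<phi> \<in> siegel \<rightarrow> Hom j"
    by (auto simp: holomorphic_Hom_def Hom_def)
  moreover have "bracket j k l F \<phi> (act \<gamma> \<tau>) = rho (k + l + 1) (autfac \<gamma> \<tau>) (bracket j k l F \<phi> \<tau>)"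
    if "\<gamma> \<in> Sp4Z" "\<tau> \<in> siegel" for \<gamma> \<tau>
    using assms(2,3) that by (intro ext bracket_transformation[where a = a, OF assms(1) a b(1) \<phi>])
      (auto simp: modular_forms_def)
  ultimately show ?thesis
    by (simp add: modular_forms_def)
qed

end
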